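(* Let $d\in\{1,2\}$, $s\geq 2$ an integer, $T>0$, $p^a=0$ and $z_b\in C^s_b(\mathbb{R}^d)$. Let $(\eta,\boldsymbol{u},w)$ be a solution of the free-surface hydrostatic Euler system (E) (written in the context) with $\eta\in C^s_b((0,T)\times\mathbb{R}^d)$, $\boldsymbol{u}\in C^s_b((0,T)\times\Omega_t)^d$ and $w\in C^s_b((0,T)\times\Omega_t)$. Let $\phi_0\in C^s_b(\tilde\Omega)$ satisfy $\phi_0(\boldsymbol{x},0)=z_b(\boldsymbol{x})$, $\phi_0(\boldsymbol{x},1)=\eta_0(\boldsymbol{x})$ and $\inf_{\mathbb{R}^d\times I}\partial_\lambda\phi_0>0$. Let $T^*\in(0,T]$ and $\phi\in C^s((0,T^* )\times\tilde\Omega)$ be such that $\phi$ is the unique solution of $$\frac{\partial\phi}{\partial t}+\boldsymbol{u}(t,\boldsymbol{x},\phi)\cdot\nabla_{\boldsymbol{x}}\phi=w(t,\boldsymbol{x},\phi)\ \text{ in }(0,T^* )\times\tilde\Omega,\qquad \phi(0,\boldsymbol{x},\lambda)=\phi_0(\boldsymbol{x},\lambda)\ \text{ in }\tilde\Omega,$$ and $(\boldsymbol{x},\lambda)\mapsto(\boldsymbol{x},\phi(t,\boldsymbol{x},\lambda))$ is an orientation preserving $C^s$-diffeomorphism from $\tilde\Omega$ to $\Omega_t$ for every $t\in(0,T^* )$. Then the functions $$H(t,\boldsymbol{x},\lambda)=\partial_\lambda\phi(t,\boldsymbol{x},\lambda),\qquad \tilde{\boldsymbol{u}}(t,\boldsymbol{x},\lambda)=\boldsymbol{u}(t,\boldsymbol{x},\phi(t,\boldsymbol{x},\lambda))$$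 have regularities $H\in C^{s-1}((0,T^* )\times\tilde\Omega)$ and $\tilde{\boldsymbol{u}}\in C^s((0,T^* )\times\tilde\Omega)^d$ and are solutions of $$\begin{cases}\partial_t H+\nabla_{\boldsymbol{x}}\cdot(H\tilde{\boldsymbol{u}})=0 & \text{in }(0,T^* )\times\tilde\Omega,\\ \partial_t\tilde{\boldsymbol{u}}+\tilde{\boldsymbol{u}}\cdot\nabla_{\boldsymbol{x}}\tilde{\boldsymbol{u}}+g\nabla_{\boldsymbol{x}}\int_0^1 H\,\mathrm{d}\lambda=-g\nabla_{\boldsymbol{x}}z_b & \text{in }(0,T^* )\times\tilde\Omega,\\ H(0,\boldsymbol{x},\lambda)=H_0(\boldsymbol{x},\lambda) & \text{in }\tilde\Omega,\\ \tilde{\boldsymbol{u}}(0,\boldsymbol{x},\lambda)=\tilde{\boldsymbol{u}}_0(\boldsymbol{x},\lambda) & \text{in }\tilde\Omega,\end{cases}$$ where the initial data are $H_0(\boldsymbol{x},\lambda)=\partial_\lambda\phi_0(\boldsymbol{x},\lambda)$ and $\tilde{\boldsymbol{u}}_0(\boldsymbol{x},\lambda)=\boldsymbol{u}(0,\boldsymbol{x},\phi_0(\boldsymbol{x},\lambda))$.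
   Context: $I=(0,1)$, $\tilde\Omega=\mathbb{R}^d\times I$; $g>0$ is the gravity constant; $z_b:\mathbb{R}^d\to\mathbb{R}$ is the time-independent bottom. $C^s_b$ denotes the space of $C^s$ functions all of whose derivatives up to order $s$ are continuous and bounded (values at boundary points such as $\lambda=0,1$ are understood by continuous extension). The fluid domain is $\Omega_t=\{(\boldsymbol{x},z)\in\mathbb{R}^d\times\mathbb{R}: z_b(\boldsymbol{x})<z<\eta(t,\boldsymbol{x})\}$ and $(0,T)\times\Omega_t$ denotes $\{(t,\boldsymbol{x},z)\in(0,T)\times\mathbb{R}^d\times\mathbb{R}:(\boldsymbol{x},z)\in\Omega_t\}$. System (E), for the unknowns $\eta(t,\boldsymbol{x})\in\mathbb{R}$, $\boldsymbol{u}(t,\boldsymbol{x},z)\in\mathbb{R}^d$ (horizontal velocity), $w(t,\boldsymbol{x},z)\in\mathbb{R}$ (vertical velocity), with $p^a$ the atmospheric pressure: $$\begin{cases}\partial_t\eta+\boldsymbol{u}_s\cdot\nabla_{\boldsymbol{x}}\eta-w_s=0 & \text{in }(0,T)\times\mathbb{R}^d,\\ \boldsymbol{u}_b\cdot\nabla_{\boldsymbol{x}}z_b-w_b=0 & \text{in }(0,T)\times\mathbb{R}^d,\\ \partial_t\boldsymbol{u}+\boldsymbol{u}\cdot\nabla_{\boldsymbol{x}}\boldsymbol{u}+w\,\partial_z\boldsymbol{u}+g\nabla_{\boldsymbol{x}}\eta=-\nabla_{\boldsymbol{x}}p^a & \text{in }(0,T)\times\Omega_t,\\ \nabla_{\boldsymbol{x}}\cdot\boldsymbol{u}+\partial_z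 w=0 & \text{in }(0,T)\times\Omega_t,\\ \boldsymbol{u}|_{t=0}=\boldsymbol{u}_0\ \text{in }\Omega_0,\qquad \eta|_{t=0}=\eta_0\ \text{in }\mathbb{R}^d,\end{cases}$$ where the subscripts $s$ and $b$ denote values at the surface and at the bottom, e.g. $w_s(t,\boldsymbol{x})=w(t,\boldsymbol{x},\eta(t,\boldsymbol{x}))$, $w_b(t,\boldsymbol{x})=w(t,\boldsymbol{x},z_b(\boldsymbol{x}))$. *)

theory Defs
  imports "HOL-Analysis.Analysis"
begin

section \<open>Functions of class \<open>C\<^sup>n\<close>\<close>

text \<open>
  Both notions are meant for open sets \<open>S\<close>: the derivatives are taken at points of \<open>S\<close> within the
  whole space, so that only the values of \<open>f\<close> on \<open>S\<close> matter. The functions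
  \<open>x \<mapsto> frechet_derivative f (at x) v\<close> with \<open>v \<in> Basis\<close> are the first order partial derivatives.
\<close>

primrec Ck_on :: "nat \<Rightarrow> ('a::euclidean_space \<Rightarrow> 'b::real_normed_vector) \<Rightarrow> 'a set \<Rightarrow> bool" where
  "Ck_on 0 f S \<longleftrightarrow> continuous_on S f"
| "Ck_on (Suc n) f S \<longleftrightarrow>
     (\<forall>x\<in>S. f differentiable (at x)) \<and>
     (\<forall>v\<in>Basis. Ck_on n (\<lambda>x. frechet_derivative f (at x) v) S)"

primrec Ckb_on :: "nat \<Rightarrow> ('a::euclidean_space \<Rightarrow> 'b::real_normed_vector) \<Rightarrow> 'a set \<Rightarrow> bool" where
  "Ckb_on 0 f S \<longleftrightarrow> continuous_on S f \<and> bounded (f ` S)"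
| "Ckb_on (Suc n) f S \<longleftrightarrow>
     bounded (f ` S) \<and>
     (\<forall>x\<in>S. f differentiable (at x)) \<and>
     (\<forall>v\<in>Basis. Ckb_on n (\<lambda>x. frechet_derivative f (at x) v) S)"


section \<open>Differential operators in the horizontal variable\<close>

text \<open>
  Time and vertical derivatives are \<^const>\<open>vector_derivative\<close> of the corresponding partial function,
  and the horizontal operators below are applied to the partial function \<open>y \<mapsto> f (t, y, z)\<close>.
\<close>

definition partial :: "'d::finite \<Rightarrow> (real^'d \<Rightarrow> 'b::real_normed_vector) \<Rightarrow> real^'d \<Rightarrow> 'b" where
  "partial i f x = frechet_derivative f (at x) (axis i 1)"

definition grad :: "(real^'d::finite \<Rightarrow> real) \<Rightarrow> real^'d \<Rightarrow> real^'d" where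
  "grad f x = (\<chi> i. partial i f x)"

definition divergence :: "(real^'d::finite \<Rightarrow> real^'d) \<Rightarrow> real^'d \<Rightarrow> real" where
  "divergence F x = (\<Sum>i\<in>UNIV. partial i F x $ i)"

text \<open>The operator \<open>v \<cdot> \<nabla>\<^sub>x\<close>, acting on scalar and on vector valued functions.\<close>

definition advect :: "real^'d::finite \<Rightarrow> (real^'d \<Rightarrow> 'b::real_normed_vector) \<Rightarrow> real^'d \<Rightarrow> 'b" where
  "advect v f x = (\<Sum>i\<in>UNIV. (v $ i) *\<^sub>R partial i f x)"


section \<open>Orientation preserving diffeomorphisms of \<open>\<real>\<^sup>d \<times> \<real>\<close>\<close>

text \<open>
  The Jacobian matrix of a map of \<open>\<real>\<^sup>d \<times> \<real>\<close> is indexed by \<^typ>\<open>'d option\<close>: the index \<open>Some i\<close> stands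
  for the \<open>i\<close>-th horizontal coordinate and \<open>None\<close> for the vertical one.
\<close>

fun hv_basis :: "'d::finite option \<Rightarrow> (real^'d) \<times> real" where
  "hv_basis (Some i) = (axis i 1, 0)"
| "hv_basis None = (0, 1)"

definition hv_jacobian ::
    "((real^'d::finite) \<times> real \<Rightarrow> (real^'d) \<times> real) \<Rightarrow> (real^'d) \<times> real \<Rightarrow> real^('d option)^('d option)"
  where
  "hv_jacobian f p = (\<chi> i j. frechet_derivative f (at p) (hv_basis j) \<bullet> hv_basis i)"

definition Ck_diffeomorphism ::
    "nat \<Rightarrow> ('a::euclidean_space \<Rightarrow> 'b::euclidean_space) \<Rightarrow> 'a set \<Rightarrow> 'b set \<Rightarrow> bool" where
  "Ck_diffeomorphism n f A B \<longleftrightarrow>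
     bij_betw f A B \<and> Ck_on n f A \<and> Ck_on n (inv_into A f) B"

definition orientation_preserving_on ::
    "((real^'d::finite) \<times> real \<Rightarrow> (real^'d) \<times> real) \<Rightarrow> ((real^'d) \<times> real) set \<Rightarrow> bool" where
  "orientation_preserving_on f A \<longleftrightarrow> (\<forall>p\<in>A. det (hv_jacobian f p) > 0)"


section \<open>Domains\<close>

definition strip :: "((real^'d::finite) \<times> real) set" where
  "strip = UNIV \<times> {0<..<1}"

definition fluid_domain :: "(real^'d::finite \<Rightarrow> real) \<Rightarrow> (real^'d \<Rightarrow> real) \<Rightarrow> ((real^'d) \<times> real) set" where
  "fluid_domain zb h = {(x, z). zb x < z \<and> z < h x}"

definition fluid_spacetime ::
    "real \<Rightarrow> (real^'d::finite \<Rightarrow> real) \<Rightarrow> (real \<times> (real^'d) \<Rightarrow> real) \<Rightarrow> (real \<times> (real^'d) \<times> real) set"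
  where
  "fluid_spacetime T zb eta =
     {(t, x, z). 0 < t \<and> t < T \<and> (x, z) \<in> fluid_domain zb (\<lambda>y. eta (t, y))}"


section \<open>The free-surface hydrostatic Euler system\<close>

text \<open>
  All unknowns are considered on open sets only; a value at a boundary point (surface, bottom,
  initial time) is the limit there from inside the domain, that is the value of the continuous
  extension.
\<close>

definition hydrostatic_euler ::
    "real \<Rightarrow> real \<Rightarrow> (real^'d::finite \<Rightarrow> real) \<Rightarrow> (real \<times> (real^'d) \<Rightarrow> real) \<Rightarrow>
     (real^'d \<Rightarrow> real) \<Rightarrow> ((real^'d) \<times> real \<Rightarrow> real^'d) \<Rightarrow>
     (real \<times> (real^'d) \<Rightarrow> real) \<Rightarrow> (real \<times> (real^'d) \<times> real \<Rightarrow> real^'d) \<Rightarrow>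
     (real \<times> (real^'d) \<times> real \<Rightarrow> real) \<Rightarrow> bool" where
  "hydrostatic_euler g T zb pa eta0 u0 eta u w \<longleftrightarrow>
    (let D = fluid_spacetime T zb eta in
      (\<forall>t\<in>{0<..<T}. \<forall>x. \<exists>us ws.
         (u \<longlongrightarrow> us) (at (t, x, eta (t, x)) within D) \<and>
         (w \<longlongrightarrow> ws) (at (t, x, eta (t, x)) within D) \<and>
         vector_derivative (\<lambda>\<tau>. eta (\<tau>, x)) (at t) + advect us (\<lambda>y. eta (t, y)) x - ws = 0) \<and>
      (\<forall>t\<in>{0<..<T}. \<forall>x. \<exists>ub wb.
         (u \<longlongrightarrow> ub) (at (t, x, zb x) within D) \<and>
         (w \<longlongrightarrow> wb) (at (t, x, zb x) within D) \<and>
         advect ub zb x - wb = 0) \<and>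
      (\<forall>t x z. (t, x, z) \<in> D \<longrightarrow>
         vector_derivative (\<lambda>\<tau>. u (\<tau>, x, z)) (at t)
           + advect (u (t, x, z)) (\<lambda>y. u (t, y, z)) x
           + w (t, x, z) *\<^sub>R vector_derivative (\<lambda>\<zeta>. u (t, x, \<zeta>)) (at z)
           + g *\<^sub>R grad (\<lambda>y. eta (t, y)) x
         = - grad (\<lambda>y. pa (t, y)) x) \<and>
      (\<forall>t x z. (t, x, z) \<in> D \<longrightarrow>
         divergence (\<lambda>y. u (t, y, z)) x + vector_derivative (\<lambda>\<zeta>. w (t, x, \<zeta>)) (at z) = 0) \<and>
      (\<forall>x z. (x, z) \<in> fluid_domain zb eta0 \<longrightarrow> (u \<longlongrightarrow> u0 (x, z)) (at (0, x, z) within D)) \<and>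
      (\<forall>x. (eta \<longlongrightarrow> eta0 x) (at (0, x) within {0<..<T} \<times> UNIV)))"


section \<open>The semi-Lagrangian change of variables\<close>

text \<open>
  The requirement that \<open>(x, \<phi> (t, x, \<lambda>))\<close> lies in the fluid domain is what gives a meaning to
  \<open>u (t, x, \<phi>)\<close> and \<open>w (t, x, \<phi>)\<close>.
\<close>

definition transport_solution ::
    "nat \<Rightarrow> real \<Rightarrow> (real^'d::finite \<Rightarrow> real) \<Rightarrow> (real \<times> (real^'d) \<Rightarrow> real) \<Rightarrow>
     (real \<times> (real^'d) \<times> real \<Rightarrow> real^'d) \<Rightarrow> (real \<times> (real^'d) \<times> real \<Rightarrow> real) \<Rightarrow>
     ((real^'d) \<times> real \<Rightarrow> real) \<Rightarrow> (real \<times> (real^'d) \<times> real \<Rightarrow> real) \<Rightarrow> bool" where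
  "transport_solution s T zb eta u w phi0 phi \<longleftrightarrow>
     Ck_on s phi ({0<..<T} \<times> strip) \<and>
     (\<forall>t\<in>{0<..<T}. \<forall>(x, l)\<in>strip.
        (x, phi (t, x, l)) \<in> fluid_domain zb (\<lambda>y. eta (t, y)) \<and>
        vector_derivative (\<lambda>\<tau>. phi (\<tau>, x, l)) (at t)
          + advect (u (t, x, phi (t, x, l))) (\<lambda>y. phi (t, y, l)) x
        = w (t, x, phi (t, x, l))) \<and>
     (\<forall>(x, l)\<in>strip. (phi \<longlongrightarrow> phi0 (x, l)) (at (0, x, l) within {0<..<T} \<times> strip))"

text \<open>
  The integrability and differentiability clauses say that the pressure term
  \<open>\<nabla>\<^sub>x \<integral>\<^sub>0\<^sup>1 H d\<lambda>\<close> is well defined.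
\<close>

definition semi_lagrangian_system ::
    "real \<Rightarrow> real \<Rightarrow> (real^'d::finite \<Rightarrow> real) \<Rightarrow>
     ((real^'d) \<times> real \<Rightarrow> real) \<Rightarrow> ((real^'d) \<times> real \<Rightarrow> real^'d) \<Rightarrow>
     (real \<times> (real^'d) \<times> real \<Rightarrow> real) \<Rightarrow> (real \<times> (real^'d) \<times> real \<Rightarrow> real^'d) \<Rightarrow> bool" where
  "semi_lagrangian_system g T zb H0 v0 H v \<longleftrightarrow>
     (\<forall>t\<in>{0<..<T}. \<forall>(x, l)\<in>strip.
        vector_derivative (\<lambda>\<tau>. H (\<tau>, x, l)) (at t)
          + divergence (\<lambda>y. H (t, y, l) *\<^sub>R v (t, y, l)) x = 0) \<and>
     (\<forall>t\<in>{0<..<T}. \<forall>x. (\<lambda>m. H (t, x, m)) absolutely_integrable_on {0<..<1}) \<and>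
     (\<forall>t\<in>{0<..<T}. \<forall>x. (\<lambda>y. integral {0<..<1} (\<lambda>m. H (t, y, m))) differentiable (at x)) \<and>
     (\<forall>t\<in>{0<..<T}. \<forall>(x, l)\<in>strip.
        vector_derivative (\<lambda>\<tau>. v (\<tau>, x, l)) (at t)
          + advect (v (t, x, l)) (\<lambda>y. v (t, y, l)) x
          + g *\<^sub>R grad (\<lambda>y. integral {0<..<1} (\<lambda>m. H (t, y, m))) x
        = - (g *\<^sub>R grad zb x)) \<and>
     (\<forall>(x, l)\<in>strip. (H \<longlongrightarrow> H0 (x, l)) (at (0, x, l) within {0<..<T} \<times> strip)) \<and>
     (\<forall>(x, l)\<in>strip. (v \<longlongrightarrow> v0 (x, l)) (at (0, x, l) within {0<..<T} \<times> strip))"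

end

theory Submission
  imports Defs
begin

text \<open>
  The evolution equations are the chain rule: with \<open>\<Phi> (t, x, \<lambda>) = (t, x, \<phi> (t, x, \<lambda>))\<close>, differentiating
  \<open>u \<circ> \<Phi>\<close> along \<open>(1, v, 0)\<close> gives the derivative of \<open>u\<close> along \<open>(1, u, w)\<close> because of the transport
  equation; differentiating the transport equation in \<open>\<lambda>\<close> and using incompressibility gives mass
  conservation. Since the diffeomorphism preserves each vertical line and the orientation, \<open>\<phi>\<close>
  increases from \<open>z\<^sub>b\<close> to \<open>\<eta>\<close> in \<open>\<lambda>\<close>, so that \<open>\<integral> H d\<lambda> = \<eta> - z\<^sub>b\<close>.

  The delicate point is that \<open>H\<close> attains its initial value, as \<open>\<phi>\<close> is only known to converge
  pointwise, without its derivatives. The graphs of \<open>\<phi> (t, \<cdot>, \<lambda>)\<close> are transported by the flow of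
  \<open>(u, w)\<close>. Tracing two points \<open>(x, \<phi> (t, x, \<lambda>))\<close> and \<open>(x, \<phi> (t, x, \<mu>))\<close> back to time \<open>0\<close>, where they
  land on the graphs of \<open>\<phi>\<^sub>0 (\<cdot>, \<lambda>)\<close> and \<open>\<phi>\<^sub>0 (\<cdot>, \<mu>)\<close>, changes their difference by a relative amount
  \<open>O(t)\<close> only. Letting \<open>\<mu> \<rightarrow> \<lambda>\<close> yields \<open>\<bar>H (t, x, \<lambda>) - \<partial>\<^sub>\<lambda>\<phi>\<^sub>0 (a, \<lambda>)\<bar> \<le> C t \<bar>H (t, x, \<lambda>)\<bar>\<close> for some
  \<open>a\<close> with \<open>\<bar>a - x\<bar> \<le> C t\<close>.
\<close>

section \<open>Calculus of \<open>C\<^sup>n\<close> functions\<close>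

lemma frechet_derivative_eqI:
  assumes "(f has_derivative f') (at x)"
  shows "frechet_derivative f (at x) = f'"
  using frechet_derivative_at[OF assms] by simp

lemma Ck_on_imp_differentiable:
  assumes "Ck_on n f S" "n > 0" "x \<in> S"
  shows "f differentiable (at x)"
  using assms by (cases n) auto

lemma Ck_on_frechet_derivative:
  assumes "Ck_on n f S" "n > 0" "x \<in> S"
  shows "(f has_derivative frechet_derivative f (at x)) (at x)"
  using Ck_on_imp_differentiable[OF assms] frechet_derivative_works by blast

text \<open>On an open set two functions that agree on \<open>S\<close> agree near each of its
  points, so their derivatives, taken within the whole space, agree on \<open>S\<close> too.\<close>

lemma Ck_on_cong:
  assumes "open S" "Ck_on n f S" "\<And>x. x \<in> S \<Longrightarrow> f x = g x"
  shows "Ck_on n g S"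
  using assms(2,3)
proof (induction n arbitrary: f g)
  case 0
  then show ?case by (simp cong: continuous_on_cong)
next
  case (Suc n)
  have D: "(g has_derivative frechet_derivative f (at x)) (at x)" if "x \<in> S" for x
    by (rule has_derivative_transform_within_open
        [OF Ck_on_frechet_derivative[OF Suc.prems(1) _ that] \<open>open S\<close> that Suc.prems(2)]) auto
  have "Ck_on n (\<lambda>x. frechet_derivative g (at x) v) S" if "v \<in> Basis" for v
    by (rule Suc.IH[of "\<lambda>x. frechet_derivative f (at x) v"])
      (use Suc.prems(1) that in \<open>auto simp: frechet_derivative_eqI[OF D]\<close>)
  then show ?case
    using D by (auto simp: differentiable_def)
qed

text \<open>Admits any explicit formula for the derivative in place of the choice term
  \<open>frechet_derivative\<close>; \<open>Ck_on_cong\<close> carries the regularity over.\<close>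

lemma Ck_on_SucI:
  assumes "open S"
    and "\<And>x. x \<in> S \<Longrightarrow> (f has_derivative f' x) (at x)"
    and "\<And>v. v \<in> Basis \<Longrightarrow> Ck_on n (\<lambda>x. f' x v) S"
  shows "Ck_on (Suc n) f S"
proof -
  have "Ck_on n (\<lambda>x. frechet_derivative f (at x) v) S" if "v \<in> Basis" for v
    by (rule Ck_on_cong[OF assms(1) assms(3)[OF that]]) (simp add: frechet_derivative_eqI[OF assms(2)])
  then show ?thesis
    using assms(2) by (auto simp: differentiable_def)
qed

lemma Ck_on_Suc_imp: "Ck_on (Suc n) f S \<Longrightarrow> Ck_on n f S"
proof (induction n arbitrary: f)
  case 0
  then show ?case
    by (auto intro!: differentiable_imp_continuous_within continuous_at_imp_continuous_on)
qed auto

lemma Ck_on_mono: "Ck_on n f S \<Longrightarrow> m \<le> n \<Longrightarrow> Ck_on m f S"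
  by (induction n) (auto simp: le_Suc_eq simp del: Ck_on.simps intro: Ck_on_Suc_imp)

lemma Ckb_on_imp_Ck_on: "Ckb_on n f S \<Longrightarrow> Ck_on n f S"
  by (induction n arbitrary: f) auto

lemma Ck_on_imp_continuous_on: "Ck_on n f S \<Longrightarrow> continuous_on S f"
  using Ck_on_mono[of n f S 0] by simp

lemma Ck_on_const: "Ck_on n (\<lambda>x. c) S"
  by (induction n arbitrary: c) (auto simp: frechet_derivative_const)

lemma Ck_on_bounded_linear:
  assumes "open S" "bounded_linear h"
  shows "Ck_on n h S"
proof (cases n)
  case 0
  then show ?thesis
    using assms(2) by (simp add: linear_continuous_on)
next
  case (Suc m)
  show ?thesis
    unfolding Suc
    by (rule Ck_on_SucI[OF \<open>open S\<close>, where f' = "\<lambda>x. h"])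
      (use assms in \<open>auto intro: bounded_linear_imp_has_derivative Ck_on_const\<close>)
qed

lemma Ck_on_add:
  assumes "open S" "Ck_on n f S" "Ck_on n g S"
  shows "Ck_on n (\<lambda>x. f x + g x) S"
  using assms(2,3)
proof (induction n arbitrary: f g)
  case 0
  then show ?case by (simp add: continuous_on_add)
next
  case (Suc n)
  show ?case
    by (rule Ck_on_SucI[OF \<open>open S\<close>, where
          f' = "\<lambda>x v. frechet_derivative f (at x) v + frechet_derivative g (at x) v"])
      (use Suc in \<open>auto intro!: has_derivative_add simp: \<open>open S\<close> frechet_derivative_works[symmetric]\<close>)
qed

lemma Ck_on_sum:
  assumes "open S" "\<And>i. i \<in> I \<Longrightarrow> Ck_on n (f i) S"
  shows "Ck_on n (\<lambda>x. \<Sum>i\<in>I. f i x) S"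
  using assms(2)
  by (induction I rule: infinite_finite_induct) (auto intro: Ck_on_const Ck_on_add[OF \<open>open S\<close>])

lemma Ck_on_scaleR:
  assumes "open S" "Ck_on n a S" "Ck_on n f S"
  shows "Ck_on n (\<lambda>x. a x *\<^sub>R f x) S"
  using assms(2,3)
proof (induction n arbitrary: a f)
  case 0
  then show ?case by (simp add: continuous_on_scaleR)
next
  case (Suc n)
  show ?case
    by (rule Ck_on_SucI[OF \<open>open S\<close>, where
          f' = "\<lambda>x v. a x *\<^sub>R frechet_derivative f (at x) v + frechet_derivative a (at x) v *\<^sub>R f x"])
      (use Suc Suc.prems[THEN Ck_on_Suc_imp] in \<open>auto intro!: has_derivative_scaleR Ck_on_add
          simp: \<open>open S\<close> frechet_derivative_works[symmetric]\<close>)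
qed

lemma Ck_on_bounded_linear_compose:
  assumes "open S" "bounded_linear h" "Ck_on n f S"
  shows "Ck_on n (\<lambda>x. h (f x)) S"
  using assms(3)
proof (induction n arbitrary: f)
  case 0
  then show ?case
    by (simp add: assms(2) bounded_linear.continuous_on)
next
  case (Suc n)
  show ?case
    by (rule Ck_on_SucI[OF \<open>open S\<close>, where f' = "\<lambda>x v. h (frechet_derivative f (at x) v)"])
      (use Suc in \<open>auto intro!: bounded_linear.has_derivative[OF assms(2)]
          simp: \<open>open S\<close> frechet_derivative_works[symmetric]\<close>)
qed

text \<open>By the chain rule, each partial derivative is a sum over the basis of components of the
  derivative of \<open>f\<close> times partial derivatives of \<open>g\<close> composed with the
  same \<open>f\<close>. The induction therefore generalises only \<open>g\<close>, and lowers the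
  regularity of \<open>f\<close> by one at each stage.\<close>

lemma Ck_on_compose:
  fixes f :: "'a::euclidean_space \<Rightarrow> 'b::euclidean_space"
  assumes "open S" "Ck_on n g U" "Ck_on n f S" "f ` S \<subseteq> U"
  shows "Ck_on n (\<lambda>x. g (f x)) S"
  using assms(2,3)
proof (induction n arbitrary: g)
  case 0
  then show ?case
    using assms(4) by (auto intro: continuous_on_compose2)
next
  case (Suc n)
  let ?Df = "\<lambda>x. frechet_derivative f (at x)" and ?Dg = "\<lambda>y. frechet_derivative g (at y)"
  show ?case
  proof (rule Ck_on_SucI[OF \<open>open S\<close>, where f' = "\<lambda>x v. \<Sum>b\<in>Basis. (?Df x v \<bullet> b) *\<^sub>R ?Dg (f x) b"])
    fix x assume x: "x \<in> S"
    have g: "(g has_derivative ?Dg (f x)) (at (f x))"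
      using Ck_on_frechet_derivative[OF Suc.prems(1)] x assms(4) by blast
    have f: "(f has_derivative ?Df x) (at x)"
      using Ck_on_frechet_derivative[OF Suc.prems(2)] x by blast
    interpret L: linear "?Dg (f x)"
      using g has_derivative_linear by blast
    have "?Dg (f x) y = (\<Sum>b\<in>Basis. (y \<bullet> b) *\<^sub>R ?Dg (f x) b)" for y
    proof -
      have "?Dg (f x) (\<Sum>b\<in>Basis. (y \<bullet> b) *\<^sub>R b) = (\<Sum>b\<in>Basis. (y \<bullet> b) *\<^sub>R ?Dg (f x) b)"
        by (simp only: L.sum L.scale)
      then show ?thesis
        by (simp only: euclidean_representation)
    qed
    from this[symmetric]
    show "((\<lambda>x. g (f x)) has_derivative (\<lambda>v. \<Sum>b\<in>Basis. (?Df x v \<bullet> b) *\<^sub>R ?Dg (f x) b)) (at x)"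
      using has_derivative_compose[OF f g] by (simp only:)
  next
    fix v :: 'a assume v: "v \<in> Basis"
    show "Ck_on n (\<lambda>x. \<Sum>b\<in>Basis. (?Df x v \<bullet> b) *\<^sub>R ?Dg (f x) b) S"
    proof (intro Ck_on_sum Ck_on_scaleR \<open>open S\<close>)
      fix b :: 'b assume b: "b \<in> Basis"
      show "Ck_on n (\<lambda>x. ?Df x v \<bullet> b) S"
        using Suc.prems(2) v
        by (auto intro!: Ck_on_bounded_linear_compose[OF \<open>open S\<close>, of "\<lambda>y. y \<bullet> b"] bounded_linear_inner_left)
      show "Ck_on n (\<lambda>x. ?Dg (f x) b) S"
        by (rule Suc.IH[OF _ Ck_on_Suc_imp]) (use Suc.prems b in auto)
    qed
  qed
qed

section \<open>Symmetry of second derivatives\<close>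

text \<open>Two applications of the mean value theorem, first along \<open>v\<close> and then along
  \<open>w\<close>. The second difference on the left is symmetric in \<open>v\<close> and
  \<open>w\<close>, which is what makes the mixed derivatives comparable.\<close>

lemma mixed_difference_mean_value:
  fixes f :: "'a::euclidean_space \<Rightarrow> real"
  assumes f: "\<And>y. y \<in> ball x r \<Longrightarrow> f differentiable (at y)"
    and fv: "\<And>y. y \<in> ball x r \<Longrightarrow> (\<lambda>y. frechet_derivative f (at y) v) differentiable (at y)"
    and v: "norm v = 1" and w: "norm w = 1" and h: "0 < h" "2 * h < r"
  shows "\<exists>p\<in>cball x (2 * h). f (x + h *\<^sub>R v + h *\<^sub>R w) - f (x + h *\<^sub>R v) - f (x + h *\<^sub>R w) + f x
           = h * h * frechet_derivative (\<lambda>y. frechet_derivative f (at y) v) (at p) w"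
proof -
  let ?D = "\<lambda>f y. frechet_derivative f (at y)"
  have dist: "dist x (x + s *\<^sub>R v + t *\<^sub>R w) \<le> 2 * h" if "0 \<le> s" "s \<le> h" "0 \<le> t" "t \<le> h" for s t
    using norm_triangle_ineq[of "s *\<^sub>R v" "t *\<^sub>R w"] that v w
    by (simp add: dist_norm norm_minus_commute add.commute)
  have inb: "x + s *\<^sub>R v + t *\<^sub>R w \<in> ball x r" if "0 \<le> s" "s \<le> h" "0 \<le> t" "t \<le> h" for s t
    using dist[OF that] h by simp
  have dv: "((\<lambda>s. f (x + s *\<^sub>R v + t *\<^sub>R w)) has_real_derivative ?D f (x + s *\<^sub>R v + t *\<^sub>R w) v) (at s)"
    if "0 \<le> s" "s \<le> h" "0 \<le> t" "t \<le> h" for s t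
  proof -
    have F: "(f has_derivative ?D f (x + s *\<^sub>R v + t *\<^sub>R w)) (at (x + s *\<^sub>R v + t *\<^sub>R w))"
      using f[OF inb[OF that]] frechet_derivative_works by blast
    have "((\<lambda>s. x + s *\<^sub>R v + t *\<^sub>R w) has_derivative (\<lambda>d. d *\<^sub>R v)) (at s)"
      by (auto intro!: derivative_eq_intros)
    from has_derivative_compose[OF this F] show ?thesis
      using linear_scale[OF has_derivative_linear[OF F]]
      by (auto simp: has_field_derivative_def mult.commute elim!: has_derivative_eq_rhs)
  qed
  \<comment> \<open>The theorem is applied to the increment
    \<open>f (x + s v + h w) - f (x + s v)\<close> as a function of \<open>s\<close>. Terms with
    coefficient 0 are kept so that \<open>dv\<close> matches with \<open>t = 0\<close>.\<close>
  have "\<exists>z>0. z < h \<and> (f (x + h *\<^sub>R v + h *\<^sub>R w) - f (x + h *\<^sub>R v + 0 *\<^sub>R w))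
          - (f (x + 0 *\<^sub>R v + h *\<^sub>R w) - f (x + 0 *\<^sub>R v + 0 *\<^sub>R w))
        = (h - 0) * (?D f (x + z *\<^sub>R v + h *\<^sub>R w) v - ?D f (x + z *\<^sub>R v + 0 *\<^sub>R w) v)"
    by (rule MVT2[OF h(1)]) (use h in \<open>auto intro!: DERIV_diff dv[of _ h] dv[of _ 0] simp del: scaleR_zero_left\<close>)
  then obtain z where z: "0 < z" "z < h"
    and e1: "f (x + h *\<^sub>R v + h *\<^sub>R w) - f (x + h *\<^sub>R v) - f (x + h *\<^sub>R w) + f x
        = h * (?D f (x + z *\<^sub>R v + h *\<^sub>R w) v - ?D f (x + z *\<^sub>R v + 0 *\<^sub>R w) v)"
    by (auto simp: algebra_simps)
  have dw: "((\<lambda>t. ?D f (x + z *\<^sub>R v + t *\<^sub>R w) v) has_real_derivative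
      ?D (\<lambda>y. ?D f y v) (x + z *\<^sub>R v + t *\<^sub>R w) w) (at t)" if "0 \<le> t" "t \<le> h" for t
  proof -
    have F: "((\<lambda>y. ?D f y v) has_derivative ?D (\<lambda>y. ?D f y v) (x + z *\<^sub>R v + t *\<^sub>R w)) (at (x + z *\<^sub>R v + t *\<^sub>R w))"
      using fv[OF inb[of z t]] that z frechet_derivative_works by fastforce
    have "((\<lambda>t. x + z *\<^sub>R v + t *\<^sub>R w) has_derivative (\<lambda>d. d *\<^sub>R w)) (at t)"
      by (auto intro!: derivative_eq_intros)
    from has_derivative_compose[OF this F] show ?thesis
      using linear_scale[OF has_derivative_linear[OF F]]
      by (auto simp: has_field_derivative_def mult.commute elim!: has_derivative_eq_rhs)
  qed
  have "\<exists>t>0. t < h \<and> ?D f (x + z *\<^sub>R v + h *\<^sub>R w) v - ?D f (x + z *\<^sub>R v + 0 *\<^sub>R w) v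
        = (h - 0) * ?D (\<lambda>y. ?D f y v) (x + z *\<^sub>R v + t *\<^sub>R w) w"
    by (rule MVT2[OF h(1)]) (rule dw)
  then obtain t where "0 < t" "t < h" and e2: "?D f (x + z *\<^sub>R v + h *\<^sub>R w) v - ?D f (x + z *\<^sub>R v + 0 *\<^sub>R w) v
        = h * ?D (\<lambda>y. ?D f y v) (x + z *\<^sub>R v + t *\<^sub>R w) w"
    by auto
  then show ?thesis
    using dist[of z t] z e1 by (intro bexI[of _ "x + z *\<^sub>R v + t *\<^sub>R w"]) auto
qed

text \<open>One and the same second difference, divided by \<open>h * h\<close>, is a value of
  either mixed derivative at a point within \<open>2 * h\<close> of \<open>x\<close>. By continuity
  each of these values is within \<open>e / 2\<close> of the value at \<open>x\<close>.\<close>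

lemma Ck_on_frechet_derivative_commute:
  fixes f :: "'a::euclidean_space \<Rightarrow> real"
  assumes S: "open S" "x \<in> S" and f: "Ck_on n f S" "n \<ge> 2"
    and v: "v \<in> Basis" and w: "w \<in> Basis"
  shows "frechet_derivative (\<lambda>y. frechet_derivative f (at y) v) (at x) w
       = frechet_derivative (\<lambda>y. frechet_derivative f (at y) w) (at x) v"
proof -
  let ?D = "\<lambda>f y. frechet_derivative f (at y)"
  have C2: "Ck_on (Suc (Suc 0)) f S"
    using Ck_on_mono[OF f(1), of "Suc (Suc 0)"] f(2) by linarith
  then have d1: "\<And>y. y \<in> S \<Longrightarrow> f differentiable (at y)"
    and d2: "\<And>v y. v \<in> Basis \<Longrightarrow> y \<in> S \<Longrightarrow> (\<lambda>y. ?D f y v) differentiable (at y)"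
    and c: "\<And>v w. v \<in> Basis \<Longrightarrow> w \<in> Basis \<Longrightarrow> continuous_on S (\<lambda>y. ?D (\<lambda>y. ?D f y v) y w)"
    by auto
  obtain r0 where r0: "r0 > 0" "ball x r0 \<subseteq> S"
    using S open_contains_ball by blast
  have d1r: "\<And>y. y \<in> ball x r0 \<Longrightarrow> f differentiable (at y)"
    and d2r: "\<And>v y. v \<in> Basis \<Longrightarrow> y \<in> ball x r0 \<Longrightarrow> (\<lambda>y. ?D f y v) differentiable (at y)"
    using d1 d2 r0 by blast+
  have "dist (?D (\<lambda>y. ?D f y v) x w) (?D (\<lambda>y. ?D f y w) x v) < e" if "e > 0" for e
  proof -
    have "\<forall>\<^sub>F y in at x. dist (?D (\<lambda>y. ?D f y v) y w) (?D (\<lambda>y. ?D f y v) x w) < e / 2"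
      "\<forall>\<^sub>F y in at x. dist (?D (\<lambda>y. ?D f y w) y v) (?D (\<lambda>y. ?D f y w) x v) < e / 2"
      using c[OF v w] c[OF w v] S \<open>e > 0\<close>
      by (auto simp: continuous_on_eq_continuous_at isCont_def simp del: less_divide_eq_numeral1 intro!: tendstoD)
    then obtain r1 where r1: "r1 > 0"
      "\<And>y. y \<noteq> x \<Longrightarrow> dist y x < r1 \<Longrightarrow> dist (?D (\<lambda>y. ?D f y v) y w) (?D (\<lambda>y. ?D f y v) x w) < e / 2
          \<and> dist (?D (\<lambda>y. ?D f y w) y v) (?D (\<lambda>y. ?D f y w) x v) < e / 2"
      using eventually_conj unfolding eventually_at by (smt (verit) UNIV_I)
    define h where "h = min r0 r1 / 3"
    have h: "0 < h" "2 * h < r0" "2 * h < r1"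
      using r0 r1 by (auto simp: h_def)
    obtain p where p: "p \<in> cball x (2 * h)"
      "f (x + h *\<^sub>R v + h *\<^sub>R w) - f (x + h *\<^sub>R v) - f (x + h *\<^sub>R w) + f x = h * h * ?D (\<lambda>y. ?D f y v) p w"
      using mixed_difference_mean_value[OF d1r d2r[OF v] norm_Basis[OF v] norm_Basis[OF w] h(1,2)] by blast
    obtain q where q: "q \<in> cball x (2 * h)"
      "f (x + h *\<^sub>R w + h *\<^sub>R v) - f (x + h *\<^sub>R w) - f (x + h *\<^sub>R v) + f x = h * h * ?D (\<lambda>y. ?D f y w) q v"
      using mixed_difference_mean_value[OF d1r d2r[OF w] norm_Basis[OF w] norm_Basis[OF v] h(1,2)] by blast
    have "h * h * ?D (\<lambda>y. ?D f y v) p w = h * h * ?D (\<lambda>y. ?D f y w) q v"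
      using p q by (simp add: algebra_simps)
    then have eq: "?D (\<lambda>y. ?D f y v) p w = ?D (\<lambda>y. ?D f y w) q v"
      using h by simp
    have "dist (?D (\<lambda>y. ?D f y v) p w) (?D (\<lambda>y. ?D f y v) x w) < e / 2"
      using r1(2)[of p] p h \<open>e > 0\<close> by (cases "p = x") (auto simp: dist_commute)
    moreover have "dist (?D (\<lambda>y. ?D f y w) q v) (?D (\<lambda>y. ?D f y w) x v) < e / 2"
      using r1(2)[of q] q h \<open>e > 0\<close> by (cases "q = x") (auto simp: dist_commute)
    ultimately show ?thesis
      using eq dist_triangle_half_r by metis
  qed
  then show ?thesis
    by (metis less_irrefl zero_less_dist_iff)
qed

section \<open>Partial functions and horizontal operators in terms of the full derivative\<close>

lemma has_derivative_slice_time: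
  assumes "(f has_derivative f') (at (t, x, l))"
  shows "((\<lambda>\<tau>. f (\<tau>, x, l)) has_vector_derivative f' (1, 0, 0)) (at t)"
proof -
  have "f' (k, 0, 0) = k *\<^sub>R f' (1, 0, 0)" for k
    using linear_scale[OF has_derivative_linear[OF assms], of k "(1, 0, 0)"] by simp
  then have *: "(\<lambda>k. f' (k, 0, 0)) = (\<lambda>k. k *\<^sub>R f' (1, 0, 0))"
    by blast
  have "((\<lambda>\<tau>. (\<tau>, x, l)) has_derivative (\<lambda>k. (k, 0, 0))) (at t)"
    by (auto simp: zero_prod_def intro!: derivative_eq_intros)
  from has_derivative_compose[OF this assms] show ?thesis
    unfolding has_vector_derivative_def * .
qed

lemma has_derivative_slice_vertical:
  assumes "(f has_derivative f') (at (t, x, l))"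
  shows "((\<lambda>m. f (t, x, m)) has_vector_derivative f' (0, 0, 1)) (at l)"
proof -
  have "f' (0, 0, k) = k *\<^sub>R f' (0, 0, 1)" for k
    using linear_scale[OF has_derivative_linear[OF assms], of k "(0, 0, 1)"] by simp
  then have *: "(\<lambda>k. f' (0, 0, k)) = (\<lambda>k. k *\<^sub>R f' (0, 0, 1))"
    by blast
  have "((\<lambda>m. (t, x, m)) has_derivative (\<lambda>k. (0, 0, k))) (at l)"
    by (auto simp: zero_prod_def intro!: derivative_eq_intros)
  from has_derivative_compose[OF this assms] show ?thesis
    unfolding has_vector_derivative_def * .
qed

lemma has_derivative_slice_horizontal:
  assumes "(f has_derivative f') (at (t, x, l))"
  shows "((\<lambda>y. f (t, y, l)) has_derivative (\<lambda>k. f' (0, k, 0))) (at x)"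
proof -
  have "((\<lambda>y. (t, y, l)) has_derivative (\<lambda>k. (0, k, 0))) (at x)"
    by (auto simp: zero_prod_def intro!: derivative_eq_intros)
  from has_derivative_compose[OF this assms] show ?thesis .
qed

lemma linear_axis_sum:
  assumes "linear f"
  shows "f v = (\<Sum>i\<in>UNIV. (v $ i) *\<^sub>R f (axis i 1))"
proof -
  interpret linear f by fact
  have "f (\<Sum>i\<in>UNIV. (v $ i) *\<^sub>R axis i 1) = (\<Sum>i\<in>UNIV. (v $ i) *\<^sub>R f (axis i 1))"
    by (simp only: sum scale)
  moreover have "(\<Sum>i\<in>UNIV. (v $ i) *\<^sub>R axis i 1) = v"
    using basis_expansion[of v] by (simp add: scalar_mult_eq_scaleR)
  ultimately show ?thesis by simp
qed

lemma partial_eq: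
  assumes "(f has_derivative f') (at x)"
  shows "partial i f x = f' (axis i 1)"
  by (simp add: partial_def frechet_derivative_eqI[OF assms])

lemma advect_eq:
  assumes "(f has_derivative f') (at x)"
  shows "advect v f x = f' v"
  unfolding advect_def partial_eq[OF assms]
  by (rule linear_axis_sum[symmetric, OF has_derivative_linear[OF assms]])

lemma divergence_eq:
  assumes "(F has_derivative F') (at x)"
  shows "divergence F x = (\<Sum>i\<in>UNIV. F' (axis i 1) $ i)"
  by (simp add: divergence_def partial_eq[OF assms])

lemma grad_diff:
  assumes "f differentiable (at x)" "h differentiable (at x)"
  shows "grad (\<lambda>y. f y - h y) x = grad f x - grad h x"
proof -
  have "((\<lambda>y. f y - h y) has_derivative
      (\<lambda>k. frechet_derivative f (at x) k - frechet_derivative h (at x) k)) (at x)"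
    using assms by (intro has_derivative_diff) (simp_all add: frechet_derivative_works[symmetric])
  then show ?thesis
    by (simp add: grad_def partial_def vec_eq_iff frechet_derivative_eqI)
qed

lemma open_strip: "open strip"
  unfolding strip_def by (intro open_Times) auto

section \<open>The vertical Jacobian and improper integration\<close>

text \<open>A permutation contributes to the Leibniz expansion only if it fixes every
  \<open>Some a\<close>; injectivity then forces it to fix \<open>None\<close> as well, so only the
  identity survives.\<close>

lemma det_option_unit_rows:
  fixes A :: "real^('d::finite option)^('d option)"
  assumes "\<And>a j. A $ Some a $ j = (if j = Some a then 1 else 0)"
  shows "det A = A $ None $ None"
proof -
  let ?t = "\<lambda>p. of_int (sign p) * (\<Prod>i\<in>UNIV. A $ i $ p i)"
  have "det A = sum ?t {id}"
    unfolding det_def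
  proof (rule sum.mono_neutral_right)
    show "\<forall>p\<in>{p. p permutes UNIV} - {id}. ?t p = 0"
    proof
      fix p :: "'d option \<Rightarrow> 'd option"
      assume p: "p \<in> {p. p permutes UNIV} - {id}"
      have "\<exists>a. p (Some a) \<noteq> Some a"
      proof (rule ccontr)
        assume "\<not> ?thesis"
        then have fixed: "p (Some a) = Some a" for a by simp
        have "inj p" using p permutes_inj by auto
        then have "p None = None"
          by (metis fixed injD not_None_eq)
        then have "p = id"
          using fixed by (metis eq_id_iff not_Some_eq)
        then show False using p by simp
      qed
      then obtain a where "A $ Some a $ p (Some a) = 0"
        using assms by auto
      then have "(\<Prod>i\<in>UNIV. A $ i $ p i) = 0"
        by (intro prod_zero) auto
      then show "?t p = 0" by simp
    qed
  qed (simp_all add: permutes_id finite_permutations)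
  also have "\<dots> = A $ None $ None * (\<Prod>i\<in>UNIV - {None}. A $ i $ i)"
    by (simp add: prod.remove[of UNIV None])
  also have "(\<Prod>i\<in>UNIV - {None}. A $ i $ i) = 1"
    by (rule prod.neutral) (metis (no_types) assms Diff_iff insertI1 not_None_eq)
  finally show ?thesis by simp
qed

text \<open>Keeping the horizontal coordinate makes the horizontal rows unit rows. Preserving
  orientation thus amounts to a positive vertical derivative.\<close>

lemma det_hv_jacobian:
  fixes h :: "(real^'d::finite) \<times> real \<Rightarrow> real"
  assumes "(h has_derivative h') (at p)"
  shows "det (hv_jacobian (\<lambda>(x, l). (x, h (x, l))) p) = h' (0, 1)"
proof -
  have "((\<lambda>(x, l). (x, h (x, l))) has_derivative (\<lambda>k. (fst k, h' k))) (at p)"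
    unfolding case_prod_beta by (auto intro!: derivative_eq_intros assms)
  note D = frechet_derivative_eqI[OF this]
  have "hv_jacobian (\<lambda>(x, l). (x, h (x, l))) p $ Some a $ j = (if j = Some a then 1 else 0)" for a j
    by (cases j) (auto simp: hv_jacobian_def D inner_axis_axis)
  then show ?thesis
    by (subst det_option_unit_rows) (auto simp: hv_jacobian_def D)
qed

text \<open>No control of \<open>f'\<close> near the end points is available, so the fundamental
  theorem is applied to a continuous extension \<open>F\<close> of \<open>f\<close> to the closed
  interval. The end limits exist because \<open>f\<close> is increasing and its image is exactly the
  interval from \<open>a\<close> to \<open>b\<close>.\<close>

lemma has_integral_deriv_open_interval:
  fixes f f' :: "real \<Rightarrow> real"
  assumes der: "\<And>l. l \<in> {0<..<1} \<Longrightarrow> (f has_real_derivative f' l) (at l)"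
    and pos: "\<And>l. l \<in> {0<..<1} \<Longrightarrow> f' l > 0"
    and img: "f ` {0<..<1} = {a<..<b}"
  shows "(f' has_integral (b - a)) {0<..<1}"
proof -
  have mono: "f l < f m" if "0 < l" "l < m" "m < 1" for l m
    by (rule DERIV_pos_imp_increasing[OF \<open>l < m\<close>]) (use der pos that in force)
  have bnd: "a < f l \<and> f l < b" if "0 < l" "l < 1" for l
    using img that by (metis greaterThanLessThan_iff imageI)
  have ab: "a < b"
    using bnd[of "1/2"] by simp
  have ev0: "\<forall>\<^sub>F m in at_right (0::real). m \<in> {0<..<1}" and ev1: "\<forall>\<^sub>F m in at_left (1::real). m \<in> {0<..<1}"
    using eventually_at_right_real[of 0 1] eventually_at_left_real[of 0 1] by auto
  have lim0: "(f \<longlongrightarrow> a) (at_right 0)"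
  proof (rule order_tendstoI)
    fix y assume "y < a"
    show "\<forall>\<^sub>F m in at_right 0. y < f m"
      using ev0 by eventually_elim (use bnd \<open>y < a\<close> in force)
  next
    fix y assume "a < y"
    \<comment> \<open>The minimum keeps the midpoint below \<open>b\<close> even if \<open>y\<close>
      exceeds \<open>b\<close>, so that it is a value of \<open>f\<close> strictly below
      \<open>y\<close>.\<close>
    then have "(a + min y b) / 2 \<in> f ` {0<..<1}"
      unfolding img using ab by auto
    then obtain l where l: "0 < l" "l < 1" "f l = (a + min y b) / 2" by auto
    have "\<forall>\<^sub>F m in at_right 0. m \<in> {0<..<l}"
      using eventually_at_right_real[of 0 l] l by auto
    then show "\<forall>\<^sub>F m in at_right 0. f m < y"
      by eventually_elim (use mono[of _ l] l \<open>a < y\<close> ab in fastforce)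
  qed
  have lim1: "(f \<longlongrightarrow> b) (at_left 1)"
  proof (rule order_tendstoI)
    fix y assume "b < y"
    show "\<forall>\<^sub>F m in at_left 1. f m < y"
      using ev1 by eventually_elim (use bnd \<open>b < y\<close> in force)
  next
    fix y assume "y < b"
    then have "(b + max y a) / 2 \<in> f ` {0<..<1}"
      unfolding img using ab by auto
    then obtain l where l: "0 < l" "l < 1" "f l = (b + max y a) / 2" by auto
    have "\<forall>\<^sub>F m in at_left 1. m \<in> {l<..<1}"
      using eventually_at_left_real[of l 1] l by auto
    then show "\<forall>\<^sub>F m in at_left 1. y < f m"
      by eventually_elim (use mono[of l] l \<open>y < b\<close> ab in fastforce)
  qed
  \<comment> \<open>The values of \<open>f\<close> outside the open interval are arbitrary, hence
    the explicit end values.\<close>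
  define F where "F l = (if l \<le> 0 then a else if l \<ge> 1 then b else f l)" for l
  have F01: "F 0 = a" "F 1 = b"
    by (simp_all add: F_def)
  have F: "(F has_real_derivative f' l) (at l)" if "l \<in> {0<..<1}" for l
    by (rule has_field_derivative_transform_within_open[OF der[OF that], of "{0<..<1}"])
      (use that in \<open>auto simp: F_def\<close>)
  have "continuous_on {0..1} F"
  proof (rule continuous_on_IccI)
    have "\<forall>\<^sub>F m in at_right 0. f m = F m"
      using ev0 by eventually_elim (simp add: F_def)
    from Lim_transform_eventually[OF lim0 this] show "(F \<longlongrightarrow> F 0) (at_right 0)"
      by (simp add: F01)
    have "\<forall>\<^sub>F m in at_left 1. f m = F m"
      using ev1 by eventually_elim (simp add: F_def)
    from Lim_transform_eventually[OF lim1 this] show "(F \<longlongrightarrow> F 1) (at_left 1)"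
      by (simp add: F01)
    show "F \<midarrow>l\<rightarrow> F l" if "0 < l" "l < 1" for l
      using DERIV_isCont[OF F, of l] that by (simp add: isCont_def)
  qed simp
  then have "(f' has_integral (F 1 - F 0)) {0..1}"
    by (intro fundamental_theorem_of_calculus_interior)
      (use F in \<open>auto simp: has_real_derivative_iff_has_vector_derivative\<close>)
  then show ?thesis
    by (simp add: F01 has_integral_Icc_iff_Ioo)
qed

section \<open>Lipschitz ordinary differential equations\<close>

text \<open>\<open>Ckb_on\<close> controls derivatives only in the directions of
  \<open>Basis\<close>; this turns such bounds into a bound in every direction.\<close>

lemma linear_norm_le_Basis_sum:
  fixes f :: "'a::euclidean_space \<Rightarrow> 'b::real_normed_vector"
  assumes "linear f"
  shows "norm (f k) \<le> (\<Sum>b\<in>Basis. norm (f b)) * norm k"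
proof -
  interpret linear f by fact
  have "f (\<Sum>b\<in>Basis. (k \<bullet> b) *\<^sub>R b) = (\<Sum>b\<in>Basis. (k \<bullet> b) *\<^sub>R f b)"
    by (simp only: sum scale)
  then have "norm (f k) = norm (\<Sum>b\<in>Basis. (k \<bullet> b) *\<^sub>R f b)"
    by (simp only: euclidean_representation)
  also have "\<dots> \<le> (\<Sum>b\<in>Basis. norm (f b) * norm k)"
    by (rule sum_norm_le) (simp add: Basis_le_norm mult.commute[of "\<bar>_\<bar>"] mult_left_mono)
  finally show ?thesis
    by (simp add: sum_distrib_right)
qed

lemma Ckb_on_imp_bounded: "Ckb_on n f S \<Longrightarrow> bounded (f ` S)"
  by (cases n) auto

lemma Ckb_on_derivative_bound:
  assumes "Ckb_on n f S" "n > 0"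
  obtains K where "K \<ge> 0" "\<And>x k. x \<in> S \<Longrightarrow> norm (frechet_derivative f (at x) k) \<le> K * norm k"
proof -
  obtain m where n: "n = Suc m"
    using assms(2) gr0_implies_Suc by blast
  have "\<exists>B. \<forall>x\<in>S. norm (frechet_derivative f (at x) b) \<le> B" if "b \<in> Basis" for b
  proof -
    have "bounded ((\<lambda>x. frechet_derivative f (at x) b) ` S)"
      using assms that by (auto simp: n intro: Ckb_on_imp_bounded)
    then show ?thesis
      by (auto simp: bounded_iff)
  qed
  then obtain B where B: "\<And>b x. b \<in> Basis \<Longrightarrow> x \<in> S \<Longrightarrow> norm (frechet_derivative f (at x) b) \<le> B b"
    by metis
  have "norm (frechet_derivative f (at x) k) \<le> (\<Sum>b\<in>Basis. \<bar>B b\<bar>) * norm k" if "x \<in> S" for x k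
  proof -
    have "linear (frechet_derivative f (at x))"
      using Ck_on_frechet_derivative[OF Ckb_on_imp_Ck_on[OF assms(1)] assms(2) that]
      by (rule has_derivative_linear)
    note linear_norm_le_Basis_sum[OF this, of k]
    also have "(\<Sum>b\<in>Basis. norm (frechet_derivative f (at x) b)) * norm k \<le> (\<Sum>b\<in>Basis. \<bar>B b\<bar>) * norm k"
      using B[OF _ that] by (intro mult_right_mono sum_mono) (auto intro: order_trans[OF _ abs_ge_self])
    finally show ?thesis .
  qed
  then show ?thesis
    by (intro that[of "\<Sum>b\<in>Basis. \<bar>B b\<bar>"]) (auto intro: sum_nonneg)
qed

text \<open>The mean value inequality needs segments inside the domain, and \<open>S\<close> need
  not be convex. A single \<open>K\<close> serves all convex subsets; for the velocity these will be
  vertical segments and small boxes.\<close>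

lemma Ckb_on_imp_lipschitz:
  fixes f :: "'a::euclidean_space \<Rightarrow> 'b::real_normed_vector"
  assumes "Ckb_on n f S" "n > 0"
  obtains K where "K \<ge> 0" "\<And>C x y. convex C \<Longrightarrow> C \<subseteq> S \<Longrightarrow> x \<in> C \<Longrightarrow> y \<in> C \<Longrightarrow> norm (f x - f y) \<le> K * norm (x - y)"
proof -
  obtain K where K: "K \<ge> 0" "\<And>x k. x \<in> S \<Longrightarrow> norm (frechet_derivative f (at x) k) \<le> K * norm k"
    using Ckb_on_derivative_bound[OF assms] by blast
  show ?thesis
  proof (rule that[OF K(1)])
    fix C x y assume C: "convex C" "C \<subseteq> S" and xy: "x \<in> C" "y \<in> C"
    show "norm (f x - f y) \<le> K * norm (x - y)"
    proof (rule differentiable_bound[OF C(1) _ _ xy])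
      fix z assume z: "z \<in> C"
      show "(f has_derivative frechet_derivative f (at z)) (at z within C)"
        using Ck_on_frechet_derivative[OF Ckb_on_imp_Ck_on[OF assms(1)] assms(2)] z C
        by (blast intro: has_derivative_at_withinI)
      show "onorm (frechet_derivative f (at z)) \<le> K"
        using z C K by (intro onorm_le) blast
    qed
  qed
qed

lemma vector_derivative_norm_bound:
  fixes y :: "real \<Rightarrow> 'e::real_normed_vector"
  assumes "\<And>\<tau>. \<tau> \<in> {a..b} \<Longrightarrow> (y has_vector_derivative y' \<tau>) (at \<tau> within {a..b})"
    and "\<And>\<tau>. \<tau> \<in> {a..b} \<Longrightarrow> norm (y' \<tau>) \<le> B"
    and "p \<in> {a..b}" "q \<in> {a..b}"
  shows "norm (y p - y q) \<le> B * \<bar>p - q\<bar>"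
proof -
  have "norm (y p - y q) \<le> B * norm (p - q)"
  proof (rule differentiable_bound[where f' = "\<lambda>\<tau> h. h *\<^sub>R y' \<tau>" and S = "{a..b}"])
    show "onorm (\<lambda>h. h *\<^sub>R y' \<tau>) \<le> B" if "\<tau> \<in> {a..b}" for \<tau>
      by (rule onorm_le) (use assms(2)[OF that] in \<open>simp add: mult.commute[of B] mult_left_mono\<close>)
  qed (use assms in \<open>auto simp: has_vector_derivative_def\<close>)
  then show ?thesis by simp
qed

text \<open>The bound on \<open>e'\<close> makes the square of \<open>e\<close> times
  \<open>exp (2 * K * tau)\<close> nondecreasing, and it vanishes at \<open>b\<close>. Squaring
  avoids differentiating an absolute value.\<close>

lemma gronwall_zero:
  fixes e e' :: "real \<Rightarrow> real"
  assumes der: "\<And>\<tau>. a < \<tau> \<Longrightarrow> \<tau> < b \<Longrightarrow> (e has_real_derivative e' \<tau>) (at \<tau>)"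
    and bound: "\<And>\<tau>. a < \<tau> \<Longrightarrow> \<tau> < b \<Longrightarrow> \<bar>e' \<tau>\<bar> \<le> K * \<bar>e \<tau>\<bar>"
    and cont: "continuous_on {a..b} e" and "e b = 0" "a \<le> b"
  shows "e a = 0"
proof -
  have "(e a)\<^sup>2 * exp (2 * K * a) \<le> (e b)\<^sup>2 * exp (2 * K * b)"
  proof (rule DERIV_nonneg_imp_increasing_open[OF \<open>a \<le> b\<close>])
    fix \<tau> assume \<tau>: "a < \<tau>" "\<tau> < b"
    have "\<bar>e \<tau> * e' \<tau>\<bar> \<le> K * (e \<tau>)\<^sup>2"
      using mult_left_mono[OF bound[OF \<tau>], of "\<bar>e \<tau>\<bar>"]
      by (simp add: abs_mult power2_eq_square mult.left_commute)
    then have "0 \<le> (2 * (e \<tau> * e' \<tau>) + 2 * K * (e \<tau>)\<^sup>2) * exp (2 * K * \<tau>)"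
      by (intro mult_nonneg_nonneg) (auto simp: abs_le_iff)
    moreover have "((\<lambda>\<tau>. (e \<tau>)\<^sup>2 * exp (2 * K * \<tau>)) has_real_derivative
        (2 * (e \<tau> * e' \<tau>) + 2 * K * (e \<tau>)\<^sup>2) * exp (2 * K * \<tau>)) (at \<tau>)"
      by (auto intro!: derivative_eq_intros der[OF \<tau>] simp: algebra_simps power2_eq_square)
    ultimately show "\<exists>y. ((\<lambda>\<tau>. (e \<tau>)\<^sup>2 * exp (2 * K * \<tau>)) has_real_derivative y) (at \<tau>) \<and> 0 \<le> y"
      by blast
  qed (intro continuous_intros cont)
  then have "(e a)\<^sup>2 * exp (2 * K * a) \<le> 0"
    using \<open>e b = 0\<close> by simp
  then show ?thesis
    by (simp add: mult_le_0_iff)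
qed

text \<open>Extend to the closure and compose with the nearest point projection, which is
  1-Lipschitz onto a closed convex set; Lipschitz constant and bound are both preserved. This makes
  a global vector field out of the velocity in a box.\<close>

lemma lipschitz_extend_convex:
  fixes f :: "'a::euclidean_space \<Rightarrow> 'b::euclidean_space"
  assumes f: "L-lipschitz_on C f" and C: "convex C" "C \<noteq> {}"
    and M: "\<And>x. x \<in> C \<Longrightarrow> norm (f x) \<le> M"
  obtains G where "L-lipschitz_on UNIV G" "\<And>x. norm (G x) \<le> M" "\<And>x. x \<in> C \<Longrightarrow> G x = f x"
proof -
  obtain h where h: "L-lipschitz_on (closure C) h" "\<And>x. x \<in> C \<Longrightarrow> h x = f x"
    using lipschitz_extend_closure[OF f] by blast
  let ?c = "closest_point (closure C)"
  have cl: "convex (closure C)" "closed (closure C)" "closure C \<noteq> {}"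
    using C by (auto simp: convex_closure)
  have "1-lipschitz_on UNIV ?c"
    by (rule lipschitz_onI) (use closest_point_lipschitz[OF cl] in auto)
  moreover have "L-lipschitz_on (?c ` UNIV) h"
    by (rule lipschitz_on_subset[OF h(1)]) (use closest_point_in_set[OF cl(2,3)] in auto)
  ultimately have "(L * 1)-lipschitz_on UNIV (h \<circ> ?c)"
    using lipschitz_on_compose by blast
  moreover have "norm (h x) \<le> M" if "x \<in> closure C" for x
    by (rule continuous_on_closure_norm_le[OF lipschitz_on_continuous_on[OF h(1)] _ that])
      (use M h(2) in auto)
  ultimately show ?thesis
    using closest_point_in_set[OF cl(2,3)] h(2)
    by (intro that[of "h \<circ> ?c"]) (auto simp: closest_point_self closure_subset[THEN subsetD])
qed

text \<open>Picard's fixed point argument with the value prescribed at the final time, since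
  characteristics are traced backwards. \<open>L * t \<le> 1 / 2\<close> makes the integral operator
  a contraction with factor \<open>1 / 2\<close> in the supremum norm.\<close>

lemma lipschitz_ode_solution:
  fixes G :: "real \<times> 'e::euclidean_space \<Rightarrow> 'e"
  assumes L: "L-lipschitz_on UNIV G" and t: "0 \<le> t" "L * t \<le> 1 / 2"
  obtains y where "y t = y1"
    "\<And>\<tau>. \<tau> \<in> {0..t} \<Longrightarrow> (y has_vector_derivative G (\<tau>, y \<tau>)) (at \<tau> within {0..t})"
proof -
  \<comment> \<open>Clamping the time to \<open>{0..t}\<close> lets the fixed point be sought among
    bounded continuous functions on the whole line, which form a complete metric space.\<close>
  let ?c = "\<lambda>\<tau>. max 0 (min \<tau> t)"
  define h where "h y = (\<lambda>\<sigma>. G (\<sigma>, apply_bcontfun y \<sigma>))" for y :: "real \<Rightarrow>\<^sub>C 'e"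
  \<comment> \<open>This is \<open>y1\<close> minus the integral from \<open>?c tau\<close> to
    \<open>t\<close>, written with base point 0 so that it can be differentiated in the upper
    limit.\<close>
  define P where "P y = (\<lambda>\<tau>. y1 - integral {0..t} (h y) + integral {0..?c \<tau>} (h y))" for y
  have h_cont: "continuous_on A (h y)" for y A
    unfolding h_def
    by (intro continuous_on_compose2[OF lipschitz_on_continuous_on[OF L]] continuous_intros) auto
  then have h_int: "h y integrable_on {a..b}" for y a b
    by (rule integrable_continuous_interval)
  have P_bcont: "P y \<in> bcontfun" for y
  proof -
    have c: "continuous_on {0..t} (\<lambda>\<tau>. integral {0..\<tau>} (h y))"
      by (rule indefinite_integral_continuous_1[OF h_int])
    have "continuous_on UNIV (P y)"
      unfolding P_def
      by (intro continuous_intros continuous_on_compose2[OF c]) (use t in auto)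
    moreover have "range (P y) \<subseteq> (\<lambda>\<tau>. y1 - integral {0..t} (h y) + integral {0..\<tau>} (h y)) ` {0..t}"
      unfolding P_def using t by auto
    then have "bounded (range (P y))"
      by (rule bounded_subset[rotated])
        (intro compact_imp_bounded compact_continuous_image continuous_intros c compact_Icc)
    ultimately show ?thesis
      by (simp add: bcontfun_def)
  qed
  define Q where "Q y = Bcontfun (P y)" for y
  have Q: "apply_bcontfun (Q y) = P y" for y
    unfolding Q_def by (rule Bcontfun_inverse[OF P_bcont])
  have "dist (Q y) (Q z) \<le> 1 / 2 * dist y z" for y z
  proof (rule dist_bound)
    fix \<tau>
    have c: "0 \<le> ?c \<tau>" "?c \<tau> \<le> t"
      using t by auto
    have "P y \<tau> = y1 - integral {?c \<tau>..t} (h y)" for y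
      using Henstock_Kurzweil_Integration.integral_combine[OF c h_int[of y]] by (simp add: P_def algebra_simps)
    then have "dist (P y \<tau>) (P z \<tau>) = norm (integral {?c \<tau>..t} (\<lambda>\<sigma>. h y \<sigma> - h z \<sigma>))"
      by (simp add: dist_norm Henstock_Kurzweil_Integration.integral_diff[OF h_int h_int] norm_minus_commute)
    also have "\<dots> \<le> L * dist y z * (t - ?c \<tau>)"
    proof (rule integral_bound[OF c(2)])
      fix \<sigma>
      have "dist (G (\<sigma>, apply_bcontfun y \<sigma>)) (G (\<sigma>, apply_bcontfun z \<sigma>))
          \<le> L * dist (\<sigma>, apply_bcontfun y \<sigma>) (\<sigma>, apply_bcontfun z \<sigma>)"
        by (rule lipschitz_onD[OF L]) auto
      also have "\<dots> \<le> L * dist y z"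
        using lipschitz_on_nonneg[OF L] dist_bounded[of y \<sigma> z]
        by (intro mult_left_mono) (auto simp: dist_Pair_Pair)
      finally show "norm (h y \<sigma> - h z \<sigma>) \<le> L * dist y z"
        by (simp add: h_def dist_norm)
    qed (intro continuous_intros h_cont)
    also have "\<dots> \<le> L * dist y z * t"
      using c lipschitz_on_nonneg[OF L] by (intro mult_left_mono) auto
    also have "\<dots> \<le> 1 / 2 * dist y z"
      using mult_right_mono[OF t(2), of "dist y z"] by (simp add: mult_ac)
    finally show "dist (apply_bcontfun (Q y) \<tau>) (apply_bcontfun (Q z) \<tau>) \<le> 1 / 2 * dist y z"
      by (simp only: Q)
  qed
  then obtain y where y: "Q y = y"
    using banach_fix_type[of "1/2" Q] by auto
  have eq: "apply_bcontfun y \<tau> = y1 - integral {0..t} (h y) + integral {0..\<tau>} (h y)"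
    if "\<tau> \<in> {0..t}" for \<tau>
  proof -
    have "apply_bcontfun y \<tau> = P y \<tau>"
      using Q[of y] y by simp
    moreover have "?c \<tau> = \<tau>"
      using that by auto
    ultimately show ?thesis
      by (simp add: P_def)
  qed
  show ?thesis
  proof (rule that[of "apply_bcontfun y"])
    show "apply_bcontfun y t = y1"
      using eq[of t] t by simp
    fix \<tau> assume \<tau>: "\<tau> \<in> {0..t}"
    have "((\<lambda>\<tau>. y1 - integral {0..t} (h y) + integral {0..\<tau>} (h y)) has_vector_derivative 0 + h y \<tau>)
        (at \<tau> within {0..t})"
      by (intro has_vector_derivative_add has_vector_derivative_const integral_has_vector_derivative h_cont \<tau>)
    then show "(apply_bcontfun y has_vector_derivative G (\<tau>, apply_bcontfun y \<tau>)) (at \<tau> within {0..t})"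
      using has_vector_derivative_transform[OF \<tau>, of "apply_bcontfun y"] eq by (simp add: h_def)
  qed
qed

text \<open>If \<open>m\<close> is the maximum of the norm of \<open>y - z\<close>, this difference
  varies by at most \<open>L * t * m\<close>, hence by at most \<open>m / 2\<close>, so that
  \<open>m\<close> is at most twice its norm at time \<open>t\<close>. The factor \<open>t\<close>
  in the conclusion matters: the relative change tends to 0 with \<open>t\<close>.\<close>

lemma ode_solutions_displacement:
  fixes G :: "real \<times> 'e::euclidean_space \<Rightarrow> 'e"
  assumes L: "L-lipschitz_on UNIV G" and t: "0 \<le> t" "L * t \<le> 1 / 2"
    and y: "\<And>\<tau>. \<tau> \<in> {0..t} \<Longrightarrow> (y has_vector_derivative G (\<tau>, y \<tau>)) (at \<tau> within {0..t})"
    and z: "\<And>\<tau>. \<tau> \<in> {0..t} \<Longrightarrow> (z has_vector_derivative G (\<tau>, z \<tau>)) (at \<tau> within {0..t})"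
  shows "norm ((y 0 - z 0) - (y t - z t)) \<le> 2 * L * t * norm (y t - z t)"
proof -
  let ?d = "\<lambda>\<tau>. y \<tau> - z \<tau>"
  have L0: "L \<ge> 0" using lipschitz_on_nonneg[OF L] .
  have d: "(?d has_vector_derivative G (\<tau>, y \<tau>) - G (\<tau>, z \<tau>)) (at \<tau> within {0..t})"
    if "\<tau> \<in> {0..t}" for \<tau>
    using has_vector_derivative_diff[OF y[OF that] z[OF that]] .
  have "continuous_on {0..t} ?d"
    using d by (meson continuous_on_eq_continuous_within has_vector_derivative_continuous)
  then have "continuous_on {0..t} (\<lambda>\<tau>. norm (?d \<tau>))"
    by (rule continuous_on_norm)
  from continuous_attains_sup[OF compact_Icc _ this]
  obtain r where r: "r \<in> {0..t}" "\<And>\<tau>. \<tau> \<in> {0..t} \<Longrightarrow> norm (?d \<tau>) \<le> norm (?d r)"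
    using t by auto
  let ?m = "norm (?d r)"
  have G: "norm (G (\<tau>, y \<tau>) - G (\<tau>, z \<tau>)) \<le> L * ?m" if "\<tau> \<in> {0..t}" for \<tau>
  proof -
    have "norm (G (\<tau>, y \<tau>) - G (\<tau>, z \<tau>)) \<le> L * norm (?d \<tau>)"
      using lipschitz_onD[OF L, of "(\<tau>, y \<tau>)" "(\<tau>, z \<tau>)"] by (simp add: dist_Pair_Pair dist_norm)
    also have "\<dots> \<le> L * ?m"
      using r(2)[OF that] L0 by (rule mult_left_mono)
    finally show ?thesis .
  qed
  have step: "norm (?d p - ?d t) \<le> L * t * ?m" if "p \<in> {0..t}" for p
  proof -
    have "norm (?d p - ?d t) \<le> L * ?m * \<bar>p - t\<bar>"
      by (rule vector_derivative_norm_bound[OF d G that]) (use t in auto)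
    also have "\<dots> \<le> L * ?m * t"
      using that L0 by (intro mult_left_mono) auto
    finally show ?thesis by (simp add: mult_ac)
  qed
  have "?m \<le> norm (?d t) + norm (?d r - ?d t)"
    by (metis add.commute diff_add_cancel norm_triangle_ineq)
  also have "\<dots> \<le> norm (?d t) + 1 / 2 * ?m"
    using step[OF r(1)] mult_right_mono[OF t(2), of ?m] by simp
  finally have "?m \<le> 2 * norm (?d t)"
    by simp
  then have "L * t * ?m \<le> L * t * (2 * norm (?d t))"
    using L0 t by (intro mult_left_mono) auto
  then show ?thesis
    using step[of 0] t by (simp add: mult_ac)
qed

section \<open>The equations in semi-Lagrangian coordinates\<close>

locale semi_lagrangian =
  fixes s :: nat and g T Tstar :: real
    and zb eta0 :: "real^'d::finite \<Rightarrow> real"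
    and u0 :: "(real^'d) \<times> real \<Rightarrow> real^'d"
    and eta :: "real \<times> (real^'d) \<Rightarrow> real"
    and u :: "real \<times> (real^'d) \<times> real \<Rightarrow> real^'d"
    and w :: "real \<times> (real^'d) \<times> real \<Rightarrow> real"
    and phi0 H0 :: "(real^'d) \<times> real \<Rightarrow> real"
    and v0 :: "(real^'d) \<times> real \<Rightarrow> real^'d"
    and phi H :: "real \<times> (real^'d) \<times> real \<Rightarrow> real"
    and v :: "real \<times> (real^'d) \<times> real \<Rightarrow> real^'d"
  assumes s2: "s \<ge> 2"
    and zb: "Ckb_on s zb UNIV"
    and euler: "hydrostatic_euler g T zb (\<lambda>_. 0) eta0 u0 eta u w"
    and eta: "Ckb_on s eta ({0<..<T} \<times> UNIV)"
    and u: "Ckb_on s u (fluid_spacetime T zb eta)"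
    and w: "Ckb_on s w (fluid_spacetime T zb eta)"
    and Tstar: "0 < Tstar" "Tstar \<le> T"
    and phi: "transport_solution s Tstar zb eta u w phi0 phi"
    and H: "\<And>t x l. H (t, x, l) = vector_derivative (\<lambda>m. phi (t, x, m)) (at l)"
    and v: "\<And>t x l. v (t, x, l) = u (t, x, phi (t, x, l))"
    and diffeo: "\<And>t. t \<in> {0<..<Tstar} \<Longrightarrow>
      Ck_diffeomorphism s (\<lambda>(x, l). (x, phi (t, x, l))) strip (fluid_domain zb (\<lambda>x. eta (t, x)))"
    and orient: "\<And>t. t \<in> {0<..<Tstar} \<Longrightarrow>
      orientation_preserving_on (\<lambda>(x, l). (x, phi (t, x, l))) strip"
    and phi0: "Ckb_on s phi0 strip"
    and phi0_bottom: "\<And>x. (phi0 \<longlongrightarrow> zb x) (at (x, 0) within strip)"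
    and phi0_surface: "\<And>x. (phi0 \<longlongrightarrow> eta0 x) (at (x, 1) within strip)"
    and phi0_inf: "(INF (x, l)\<in>strip. vector_derivative (\<lambda>m. phi0 (x, m)) (at l)) > 0"
    and H0: "\<And>x l. H0 (x, l) = vector_derivative (\<lambda>m. phi0 (x, m)) (at l)"
    and v0: "\<And>x l. v0 (x, l) = u0 (x, phi0 (x, l))"
begin

definition "S = {0<..<Tstar} \<times> (strip :: ((real^'d) \<times> real) set)"
definition "D = fluid_spacetime T zb eta"
definition "Phi = (\<lambda>(t, x, l). (t, x, phi (t, x, l)))"

abbreviation "Dphi p \<equiv> frechet_derivative phi (at p)"
abbreviation "Du p \<equiv> frechet_derivative u (at p)"
abbreviation "Dw p \<equiv> frechet_derivative w (at p)"

lemma s_pos: "s > 0"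
  using s2 by simp

lemma v_eq: "v p = u (Phi p)"
  by (cases p) (simp add: v Phi_def)

lemma open_S: "open S"
  unfolding S_def by (intro open_Times open_strip) auto

lemma mem_S: "(t, x, l) \<in> S \<longleftrightarrow> 0 < t \<and> t < Tstar \<and> 0 < l \<and> l < 1"
  by (auto simp: S_def strip_def)

lemma Phi_D: "p \<in> S \<Longrightarrow> Phi p \<in> D"
  using phi Tstar
  by (cases p) (fastforce simp: Phi_def D_def S_def fluid_spacetime_def transport_solution_def)

lemma phi_Ck: "Ck_on s phi S"
  using phi by (simp add: transport_solution_def S_def)

lemma phi_deriv: "p \<in> S \<Longrightarrow> (phi has_derivative Dphi p) (at p)"
  using Ck_on_frechet_derivative[OF phi_Ck] s2 by simp

lemma u_deriv: "p \<in> D \<Longrightarrow> (u has_derivative Du p) (at p)"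
  using Ck_on_frechet_derivative[OF Ckb_on_imp_Ck_on[OF u]] s2 by (simp add: D_def)

lemma w_deriv: "p \<in> D \<Longrightarrow> (w has_derivative Dw p) (at p)"
  using Ck_on_frechet_derivative[OF Ckb_on_imp_Ck_on[OF w]] s2 by (simp add: D_def)

lemma H_eq: "p \<in> S \<Longrightarrow> H p = Dphi p (0, 0, 1)"
  using vector_derivative_at[OF has_derivative_slice_vertical[OF phi_deriv]]
  by (cases p) (simp add: H)

lemma H_Ck: "Ck_on (s - 1) H S"
proof (rule Ck_on_cong[OF open_S])
  have "Ck_on (Suc (s - 1)) phi S"
    using phi_Ck s2 by simp
  moreover have "(0, 0, 1) \<in> (Basis :: (real \<times> (real^'d) \<times> real) set)"
    by (simp add: Basis_prod_def zero_prod_def)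
  ultimately show "Ck_on (s - 1) (\<lambda>p. Dphi p (0, 0, 1)) S"
    by simp
qed (simp add: H_eq)

lemma Phi_Ck: "Ck_on s Phi S"
proof -
  have "Ck_on s (\<lambda>p. (fst p, fst (snd p), 0) + (0, 0, phi p)) S"
  proof (intro Ck_on_add open_S)
    have "bounded_linear (\<lambda>p :: real \<times> (real^'d) \<times> real. (fst p, fst (snd p), 0::real))"
      by (intro bounded_linear_Pair bounded_linear_fst bounded_linear_zero
          bounded_linear_compose[OF bounded_linear_fst bounded_linear_snd])
    then show "Ck_on s (\<lambda>p. (fst p, fst (snd p), 0::real)) S"
      by (rule Ck_on_bounded_linear[OF open_S])
    have "bounded_linear (\<lambda>z::real. (0::real, 0::real^'d, z))"
      by (intro bounded_linear_Pair bounded_linear_zero bounded_linear_ident)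
    then show "Ck_on s (\<lambda>p. (0::real, 0::real^'d, phi p)) S"
      by (rule Ck_on_bounded_linear_compose[OF open_S _ phi_Ck])
  qed
  then show ?thesis
    by (rule Ck_on_cong[OF open_S]) (auto simp: Phi_def)
qed

lemma v_Ck: "Ck_on s v S"
proof -
  have "Ck_on s (\<lambda>p. u (Phi p)) S"
    by (rule Ck_on_compose[OF open_S Ckb_on_imp_Ck_on[OF u] Phi_Ck]) (use Phi_D D_def in auto)
  then show ?thesis
    by (simp add: v_eq[abs_def])
qed

lemma Phi_deriv: "p \<in> S \<Longrightarrow> (Phi has_derivative (\<lambda>k. (fst k, fst (snd k), Dphi p k))) (at p)"
  unfolding Phi_def case_prod_beta by (auto intro!: derivative_eq_intros phi_deriv)

lemma v_deriv: "p \<in> S \<Longrightarrow> (v has_derivative (\<lambda>k. Du (Phi p) (fst k, fst (snd k), Dphi p k))) (at p)"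
  using has_derivative_compose[OF Phi_deriv u_deriv[OF Phi_D]] by (simp add: v_eq[abs_def])

section \<open>The evolution equations by the chain rule\<close>

text \<open>By linearity, time derivative and advection merge into one derivative along
  \<open>(1, v p, 0)\<close>, which is the form that the chain rule produces.\<close>

lemma transport_eq:
  assumes "p \<in> S"
  shows "Dphi p (1, v p, 0) = w (Phi p)"
proof -
  obtain t x l where p: "p = (t, x, l)" by (cases p)
  note d = phi_deriv[OF assms, unfolded p]
  interpret linear "Dphi p"
    using d has_derivative_linear p by blast
  have "vector_derivative (\<lambda>\<tau>. phi (\<tau>, x, l)) (at t)
          + advect (u (t, x, phi (t, x, l))) (\<lambda>y. phi (t, y, l)) x = w (t, x, phi (t, x, l))"
    using phi assms by (fastforce simp: p S_def transport_solution_def)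
  then show ?thesis
    using add[of "(1, 0, 0)" "(0, v p, 0)"]
    by (simp add: p vector_derivative_at[OF has_derivative_slice_time[OF d]]
        advect_eq[OF has_derivative_slice_horizontal[OF d]] Phi_def v)
qed

lemma momentum_eq:
  assumes "p \<in> D"
  shows "Du p (1, u p, w p) = - (g *\<^sub>R grad (\<lambda>y. eta (fst p, y)) (fst (snd p)))"
proof -
  obtain t x z where p: "p = (t, x, z)" by (cases p)
  note d = u_deriv[OF assms, unfolded p]
  interpret linear "Du p"
    using d has_derivative_linear p by blast
  have "vector_derivative (\<lambda>\<tau>. u (\<tau>, x, z)) (at t)
           + advect (u (t, x, z)) (\<lambda>y. u (t, y, z)) x
           + w (t, x, z) *\<^sub>R vector_derivative (\<lambda>\<zeta>. u (t, x, \<zeta>)) (at z)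
           + g *\<^sub>R grad (\<lambda>y. eta (t, y)) x = - grad (\<lambda>y. 0) x"
    using euler assms by (simp add: p D_def hydrostatic_euler_def Let_def)
  moreover have "grad (\<lambda>y. 0) x = 0"
    by (simp add: grad_def partial_def vec_eq_iff frechet_derivative_const)
  moreover have "Du p (1, u p, w p) = Du p (1, 0, 0) + Du p (0, u p, 0) + w p *\<^sub>R Du p (0, 0, 1)"
    using add[of "(1, 0, 0)" "(0, u p, 0)"] add[of "(1, u p, 0)" "(0, 0, w p)"] scale[of "w p" "(0, 0, 1)"]
    by simp
  ultimately show ?thesis
    by (simp add: p vector_derivative_at[OF has_derivative_slice_time[OF d]]
        vector_derivative_at[OF has_derivative_slice_vertical[OF d]]
        advect_eq[OF has_derivative_slice_horizontal[OF d]] eq_neg_iff_add_eq_0)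
qed

text \<open>The derivative of \<open>Phi\<close> sends \<open>(1, v, 0)\<close> to
  \<open>(1, u, w)\<close>, the last component being \<open>transport_eq\<close>. The vertical
  advection term is thereby absorbed into the change of variables.\<close>

lemma velocity_eq:
  assumes "(t, x, l) \<in> S"
  shows "vector_derivative (\<lambda>\<tau>. v (\<tau>, x, l)) (at t) + advect (v (t, x, l)) (\<lambda>y. v (t, y, l)) x
    = - (g *\<^sub>R grad (\<lambda>y. eta (t, y)) x)"
proof -
  let ?p = "(t, x, l)"
  note d = v_deriv[OF assms]
  interpret L: linear "\<lambda>k. Du (Phi ?p) (fst k, fst (snd k), Dphi ?p k)"
    using d has_derivative_linear by blast
  have "vector_derivative (\<lambda>\<tau>. v (\<tau>, x, l)) (at t) + advect (v (t, x, l)) (\<lambda>y. v (t, y, l)) x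
      = Du (Phi ?p) (1, v ?p, Dphi ?p (1, v ?p, 0))"
    using L.add[of "(1, 0, 0)" "(0, v ?p, 0)"]
    by (simp add: vector_derivative_at[OF has_derivative_slice_time[OF d]]
        advect_eq[OF has_derivative_slice_horizontal[OF d]])
  also have "\<dots> = Du (Phi ?p) (1, u (Phi ?p), w (Phi ?p))"
    by (simp add: transport_eq[OF assms] v_eq[symmetric])
  finally show ?thesis
    using momentum_eq[OF Phi_D[OF assms]] by (simp add: Phi_def)
qed

lemma incompressible:
  assumes "p \<in> D"
  shows "(\<Sum>i\<in>UNIV. Du p (0, axis i 1, 0) $ i) + Dw p (0, 0, 1) = 0"
proof -
  obtain t x z where p: "p = (t, x, z)" by (cases p)
  note d = u_deriv[OF assms, unfolded p] and d' = w_deriv[OF assms, unfolded p]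
  have "divergence (\<lambda>y. u (t, y, z)) x + vector_derivative (\<lambda>\<zeta>. w (t, x, \<zeta>)) (at z) = 0"
    using euler assms by (simp add: p D_def hydrostatic_euler_def Let_def)
  then show ?thesis
    by (simp add: p vector_derivative_at[OF has_derivative_slice_vertical[OF d']]
        divergence_eq[OF has_derivative_slice_horizontal[OF d]])
qed

lemma Basis_spacetime:
  "(1, 0, 0) \<in> (Basis :: (real \<times> (real^'d) \<times> real) set)"
  "(0, axis i 1, 0) \<in> (Basis :: (real \<times> (real^'d) \<times> real) set)"
  "(0, 0, 1) \<in> (Basis :: (real \<times> (real^'d) \<times> real) set)"
  by (auto simp: Basis_prod_def zero_prod_def image_iff Basis_vec_def)

lemma partial_phi_deriv:
  assumes "p \<in> S" "b \<in> Basis"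
  shows "((\<lambda>q. Dphi q b) has_derivative frechet_derivative (\<lambda>q. Dphi q b) (at p)) (at p)"
proof -
  have "Ck_on (Suc (s - 1)) phi S"
    using phi_Ck s2 by simp
  then have "Ck_on (s - 1) (\<lambda>q. Dphi q b) S"
    using assms by simp
  from Ck_on_frechet_derivative[OF this _ assms(1)] show ?thesis
    using s2 by simp
qed

text \<open>Differentiating the transport equation in the vertical variable and exchanging
  derivatives of \<open>phi\<close> expresses the transport of \<open>H\<close> by the vertical
  derivatives of \<open>u\<close> and \<open>w\<close>. The products of \<open>?uz\<close> with the
  slopes of \<open>phi\<close> cancel against those in the divergence of \<open>v\<close>, leaving
  \<open>H\<close> times the divergence of \<open>(u, w)\<close>.\<close>

lemma mass_eq:
  assumes "(t, x, l) \<in> S"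
  shows "vector_derivative (\<lambda>\<tau>. H (\<tau>, x, l)) (at t)
    + divergence (\<lambda>y. H (t, y, l) *\<^sub>R v (t, y, l)) x = 0"
proof -
  let ?p = "(t, x, l)"
  let ?et = "(1, 0, 0) :: real \<times> (real^'d) \<times> real"
    and ?ex = "\<lambda>i. (0, axis i 1, 0) :: real \<times> (real^'d) \<times> real"
    and ?ez = "(0, 0, 1) :: real \<times> (real^'d) \<times> real"
  let ?DD = "\<lambda>b. frechet_derivative (\<lambda>q. Dphi q b) (at ?p)"
  let ?h = "Dphi ?p ?ez"
  let ?uz = "Du (Phi ?p) ?ez"
  have Hd: "(H has_derivative ?DD ?ez) (at ?p)"
    by (rule has_derivative_transform_within_open[OF partial_phi_deriv[OF assms Basis_spacetime(3)] open_S assms])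
      (simp add: H_eq)
  note vd = v_deriv[OF assms]
  note Hvd = has_derivative_scaleR[OF Hd vd]
  interpret U: linear "Du (Phi ?p)"
    using u_deriv[OF Phi_D[OF assms]] has_derivative_linear by blast
  interpret W: linear "Dw (Phi ?p)"
    using w_deriv[OF Phi_D[OF assms]] has_derivative_linear by blast
  have Dv: "Du (Phi ?p) (0, axis i 1, Dphi ?p (?ex i)) = Du (Phi ?p) (?ex i) + Dphi ?p (?ex i) *\<^sub>R ?uz" for i
    using U.add[of "?ex i" "(0, 0, Dphi ?p (?ex i))"] U.scale[of "Dphi ?p (?ex i)" ?ez] by simp
  have sym: "?DD b ?ez = ?DD ?ez b" if "b \<in> Basis" for b
    by (rule Ck_on_frechet_derivative_commute[OF open_S assms phi_Ck s2 that Basis_spacetime(3)])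
  \<comment> \<open>The left side of the transport equation in coordinates. Its derivative is
    computed twice, by the product rule and as the derivative of \<open>w (Phi q)\<close>; comparing
    both in direction \<open>?ez\<close> gives \<open>key\<close>.\<close>
  define F where "F = (\<lambda>q. Dphi q ?et + (\<Sum>i\<in>UNIV. v q $ i * Dphi q (?ex i)))"
  have "F q = w (Phi q)" if "q \<in> S" for q
  proof -
    interpret linear "Dphi q"
      using phi_deriv[OF that] has_derivative_linear by blast
    have "Dphi q (0, v q, 0) = (\<Sum>i\<in>UNIV. v q $ i * Dphi q (?ex i))"
      using linear_axis_sum[of "\<lambda>k. Dphi q (0, k, 0)" "v q"]
        linear_compose[of "\<lambda>k. (0, k, 0)" "Dphi q"] linear_axioms
      by (auto simp: o_def linear_iff)
    then show ?thesis
      using add[of "(1, 0, 0)" "(0, v q, 0)"] transport_eq[OF that] by (simp add: F_def)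
  qed
  then have "(F has_derivative (\<lambda>k. Dw (Phi ?p) (fst k, fst (snd k), Dphi ?p k))) (at ?p)"
    by (intro has_derivative_transform_within_open[OF
          has_derivative_compose[OF Phi_deriv w_deriv[OF Phi_D]] open_S assms] assms) auto
  moreover have "(F has_derivative (\<lambda>k. ?DD ?et k + (\<Sum>i\<in>UNIV. v ?p $ i * ?DD (?ex i) k
      + Du (Phi ?p) (fst k, fst (snd k), Dphi ?p k) $ i * Dphi ?p (?ex i)))) (at ?p)"
    unfolding F_def
    by (intro has_derivative_add has_derivative_sum has_derivative_mult partial_phi_deriv assms
        Basis_spacetime bounded_linear.has_derivative[OF bounded_linear_vec_nth vd])
  ultimately have "(\<lambda>k. Dw (Phi ?p) (fst k, fst (snd k), Dphi ?p k)) = (\<lambda>k. ?DD ?et k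
      + (\<Sum>i\<in>UNIV. v ?p $ i * ?DD (?ex i) k
      + Du (Phi ?p) (fst k, fst (snd k), Dphi ?p k) $ i * Dphi ?p (?ex i)))"
    by (rule has_derivative_unique)
  from fun_cong[OF this, of ?ez]
  have key: "?h * Dw (Phi ?p) ?ez = ?DD ?ez ?et
      + (\<Sum>i\<in>UNIV. v ?p $ i * ?DD ?ez (?ex i) + ?h * ?uz $ i * Dphi ?p (?ex i))"
    using U.scale[of ?h ?ez] W.scale[of ?h ?ez] by (simp add: sym Basis_spacetime)
  have "vector_derivative (\<lambda>\<tau>. H (\<tau>, x, l)) (at t) + divergence (\<lambda>y. H (t, y, l) *\<^sub>R v (t, y, l)) x
     = ?DD ?ez ?et + (\<Sum>i\<in>UNIV. ?h * (Du (Phi ?p) (?ex i) $ i + Dphi ?p (?ex i) * ?uz $ i)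
        + ?DD ?ez (?ex i) * v ?p $ i)"
    by (simp add: vector_derivative_at[OF has_derivative_slice_time[OF Hd]]
        divergence_eq[OF has_derivative_slice_horizontal[OF Hvd]] H_eq[OF assms] Dv)
  also have "\<dots> = ?h * ((\<Sum>i\<in>UNIV. Du (Phi ?p) (?ex i) $ i) + Dw (Phi ?p) ?ez)"
    by (simp add: distrib_left key sum.distrib sum_distrib_left algebra_simps)
  also have "\<dots> = 0"
    using incompressible[OF Phi_D[OF assms]] by simp
  finally show ?thesis .
qed

section \<open>Vertical monotonicity and the pressure term\<close>

lemma H_pos:
  assumes "(t, x, l) \<in> S"
  shows "H (t, x, l) > 0"
proof -
  have "((\<lambda>q. (t, q)) has_derivative (\<lambda>k. (0, k))) (at (x, l))"
    by (auto intro!: derivative_eq_intros)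
  from has_derivative_compose[OF this phi_deriv[OF assms]]
  have "det (hv_jacobian (\<lambda>(x, l). (x, phi (t, x, l))) (x, l)) = Dphi (t, x, l) (0, 0, 1)"
    by (rule det_hv_jacobian)
  then show ?thesis
    using orient[of t] assms by (auto simp: orientation_preserving_on_def H_eq S_def)
qed

text \<open>The map fixes \<open>x\<close>, so its surjectivity onto the fluid domain can be read on
  each vertical line. This recovers the bottom and surface values of \<open>phi\<close> at positive
  times, as end points of the image.\<close>

lemma phi_slice_image:
  assumes "t \<in> {0<..<Tstar}"
  shows "(\<lambda>l. phi (t, x, l)) ` {0<..<1} = {zb x<..<eta (t, x)}"
proof -
  have "(\<lambda>(x, l). (x, phi (t, x, l))) ` strip = fluid_domain zb (\<lambda>x. eta (t, x))"
    using diffeo[OF assms] by (simp add: Ck_diffeomorphism_def bij_betw_def)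
  then have "(x, z) \<in> (\<lambda>(x, l). (x, phi (t, x, l))) ` strip \<longleftrightarrow> zb x < z \<and> z < eta (t, x)" for z
    by (simp add: fluid_domain_def)
  then show ?thesis
    by (fastforce simp: strip_def image_iff set_eq_iff)
qed

lemma H_has_integral:
  assumes "t \<in> {0<..<Tstar}"
  shows "((\<lambda>m. H (t, x, m)) has_integral (eta (t, x) - zb x)) {0<..<1}"
proof (rule has_integral_deriv_open_interval[OF _ _ phi_slice_image[OF assms]])
  fix l :: real assume "l \<in> {0<..<1}"
  then have p: "(t, x, l) \<in> S" using assms by (auto simp: mem_S)
  show "((\<lambda>l. phi (t, x, l)) has_real_derivative H (t, x, l)) (at l)"
    using has_derivative_slice_vertical[OF phi_deriv[OF p]]
    by (simp add: H_eq[OF p] has_real_derivative_iff_has_vector_derivative)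
  show "H (t, x, l) > 0"
    by (rule H_pos[OF p])
qed

lemma H_absolutely_integrable:
  assumes "t \<in> {0<..<Tstar}"
  shows "(\<lambda>m. H (t, x, m)) absolutely_integrable_on {0<..<1}"
  using assms H_has_integral[OF assms] H_pos
  by (intro nonnegative_absolutely_integrable_1) (auto simp: mem_S less_imp_le)

lemma depth_differentiable:
  assumes "t \<in> {0<..<Tstar}"
  shows "(\<lambda>y. eta (t, y)) differentiable (at x)" "zb differentiable (at x)"
proof -
  have "eta differentiable (at (t, x))"
    using Ck_on_imp_differentiable[OF Ckb_on_imp_Ck_on[OF eta]] s2 assms Tstar by auto
  moreover have "((\<lambda>y. (t, y)) has_derivative (\<lambda>k. (0, k))) (at x)"
    by (auto intro!: derivative_eq_intros)
  ultimately show "(\<lambda>y. eta (t, y)) differentiable (at x)"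
    using has_derivative_compose unfolding differentiable_def by blast
  show "zb differentiable (at x)"
    using Ck_on_imp_differentiable[OF Ckb_on_imp_Ck_on[OF zb]] s2 by auto
qed

lemma integral_H:
  assumes "t \<in> {0<..<Tstar}"
  shows "integral {0<..<1} (\<lambda>m. H (t, x, m)) = eta (t, x) - zb x"
  using H_has_integral[OF assms] by (rule integral_unique)

lemma velocity_pressure_eq:
  assumes "(t, x, l) \<in> S"
  shows "vector_derivative (\<lambda>\<tau>. v (\<tau>, x, l)) (at t) + advect (v (t, x, l)) (\<lambda>y. v (t, y, l)) x
      + g *\<^sub>R grad (\<lambda>y. integral {0<..<1} (\<lambda>m. H (t, y, m))) x = - (g *\<^sub>R grad zb x)"
proof -
  have t: "t \<in> {0<..<Tstar}"
    using assms by (simp add: mem_S)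
  show ?thesis
    unfolding velocity_eq[OF assms] integral_H[OF t] grad_diff[OF depth_differentiable[OF t]]
    by (simp add: algebra_simps)
qed

section \<open>Initial values\<close>

lemma vertical_lipschitz:
  obtains K where "K \<ge> 0"
    "\<And>t x z z'. (t, x, z) \<in> D \<Longrightarrow> (t, x, z') \<in> D \<Longrightarrow> norm (u (t, x, z) - u (t, x, z')) \<le> K * \<bar>z - z'\<bar>"
    "\<And>t x z z'. (t, x, z) \<in> D \<Longrightarrow> (t, x, z') \<in> D \<Longrightarrow> \<bar>w (t, x, z) - w (t, x, z')\<bar> \<le> K * \<bar>z - z'\<bar>"
proof -
  obtain Ku where Ku: "Ku \<ge> 0" "\<And>C p q. convex C \<Longrightarrow> C \<subseteq> D \<Longrightarrow> p \<in> C \<Longrightarrow> q \<in> C \<Longrightarrow> norm (u p - u q) \<le> Ku * norm (p - q)"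
    using Ckb_on_imp_lipschitz[OF u s_pos] unfolding D_def by blast
  obtain Kw where Kw: "Kw \<ge> 0" "\<And>C p q. convex C \<Longrightarrow> C \<subseteq> D \<Longrightarrow> p \<in> C \<Longrightarrow> q \<in> C \<Longrightarrow> norm (w p - w q) \<le> Kw * norm (p - q)"
    using Ckb_on_imp_lipschitz[OF w s_pos] unfolding D_def by blast
  have seg: "convex ({t} \<times> {x} \<times> {zb x<..<eta (t, x)})" "(t, x, z) \<in> {t} \<times> {x} \<times> {zb x<..<eta (t, x)}"
    "{t} \<times> {x} \<times> {zb x<..<eta (t, x)} \<subseteq> D" if "(t, x, z) \<in> D" for t x z
    using that by (auto simp: D_def fluid_spacetime_def fluid_domain_def intro!: convex_Times)
  show ?thesis
  proof (rule that[of "Ku + Kw"])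
    fix t x z z' assume z: "(t, x, z) \<in> D" and z': "(t, x, z') \<in> D"
    have n: "norm ((t, x, z) - (t, x, z')) = \<bar>z - z'\<bar>"
      by (simp add: norm_Pair)
    have "norm (u (t, x, z) - u (t, x, z')) \<le> Ku * \<bar>z - z'\<bar>"
      using Ku(2)[OF seg(1,3,2)[OF z] seg(2)[OF z']] n by simp
    also have "\<dots> \<le> (Ku + Kw) * \<bar>z - z'\<bar>"
      using Kw by (intro mult_right_mono) auto
    finally show "norm (u (t, x, z) - u (t, x, z')) \<le> (Ku + Kw) * \<bar>z - z'\<bar>" .
    have "\<bar>w (t, x, z) - w (t, x, z')\<bar> \<le> Kw * \<bar>z - z'\<bar>"
      using Kw(2)[OF seg(1,3,2)[OF z] seg(2)[OF z']] n by simp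
    also have "\<dots> \<le> (Ku + Kw) * \<bar>z - z'\<bar>"
      using Ku by (intro mult_right_mono) auto
    finally show "\<bar>w (t, x, z) - w (t, x, z')\<bar> \<le> (Ku + Kw) * \<bar>z - z'\<bar>" .
  qed (use Ku Kw in auto)
qed

text \<open>
  The derivatives of \<open>\<phi>\<close> are only bounded away from time \<open>0\<close>, so Gronwall's inequality is applied on
  each \<open>[a, t]\<close> with \<open>a > 0\<close>. Comparing \<open>u\<close> and \<open>w\<close> at the two heights needs no smallness, since the
  fluid domain is convex in the vertical direction.
\<close>

lemma characteristic_on_graph:
  fixes y y' :: "real \<Rightarrow> (real^'d) \<times> real"
  assumes t: "0 < t" "t < Tstar" and l: "0 < l" "l < 1"
    and y: "\<And>\<tau>. \<tau> \<in> {0..t} \<Longrightarrow> (y has_vector_derivative y' \<tau>) (at \<tau> within {0..t})"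
    and D: "\<And>\<tau>. \<tau> \<in> {0<..t} \<Longrightarrow> (\<tau>, y \<tau>) \<in> D"
    and y': "\<And>\<tau>. \<tau> \<in> {0<..t} \<Longrightarrow> y' \<tau> = (u (\<tau>, y \<tau>), w (\<tau>, y \<tau>))"
    and at_t: "snd (y t) = phi (t, fst (y t), l)"
    and a: "a \<in> {0<..t}"
  shows "snd (y a) = phi (a, fst (y a), l)"
proof -
  define p where "p \<tau> = (\<tau>, fst (y \<tau>), l)" for \<tau>
  \<comment> \<open>The height of the curve above the graph of \<open>phi\<close> at level
    \<open>l\<close>, to be shown zero by \<open>gronwall_zero\<close>.\<close>
  define e where "e \<tau> = snd (y \<tau>) - phi (p \<tau>)" for \<tau>
  define e' where "e' \<tau> = w (\<tau>, y \<tau>) - Dphi (p \<tau>) (1, u (\<tau>, y \<tau>), 0)" for \<tau>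
  obtain K where K: "K \<ge> 0"
    "\<And>t x z z'. (t, x, z) \<in> D \<Longrightarrow> (t, x, z') \<in> D \<Longrightarrow> norm (u (t, x, z) - u (t, x, z')) \<le> K * \<bar>z - z'\<bar>"
    "\<And>t x z z'. (t, x, z) \<in> D \<Longrightarrow> (t, x, z') \<in> D \<Longrightarrow> \<bar>w (t, x, z) - w (t, x, z')\<bar> \<le> K * \<bar>z - z'\<bar>"
    using vertical_lipschitz by blast
  have pS: "p \<tau> \<in> S" if "\<tau> \<in> {a..t}" for \<tau>
    using that a t l by (auto simp: p_def mem_S)
  have y_cont: "continuous_on {a..t} y"
  proof (rule continuous_on_subset)
    show "continuous_on {0..t} y"
      using y by (meson continuous_on_eq_continuous_within has_vector_derivative_continuous)
  qed (use a in auto)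
  have p_cont: "continuous_on {a..t} p"
    unfolding p_def by (intro continuous_intros y_cont)
  \<comment> \<open>By \<open>linear_norm_le_Basis_sum\<close> this sum dominates
    \<open>Dphi\<close> in every direction; compactness of \<open>{a..t}\<close> with
    \<open>a > 0\<close> provides its bound \<open>N\<close>.\<close>
  have "continuous_on {a..t} (\<lambda>\<tau>. \<Sum>b\<in>Basis. norm (Dphi (p \<tau>) b))"
  proof (intro continuous_intros)
    fix b :: "real \<times> (real^'d) \<times> real" assume b: "b \<in> Basis"
    have "continuous_on S (\<lambda>q. Dphi q b)"
      using partial_phi_deriv[OF _ b]
      by (meson continuous_at_imp_continuous_on has_derivative_continuous)
    then show "continuous_on {a..t} (\<lambda>\<tau>. Dphi (p \<tau>) b)"
      by (rule continuous_on_compose2[OF _ p_cont]) (use pS in auto)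
  qed
  from continuous_attains_sup[OF compact_Icc _ this]
  obtain N where N: "\<And>\<tau>. \<tau> \<in> {a..t} \<Longrightarrow> (\<Sum>b\<in>Basis. norm (Dphi (p \<tau>) b)) \<le> N"
    using a by fastforce
  have "e a = 0"
  proof (rule gronwall_zero[of a t e e' "K + N * K"])
    fix \<tau> assume \<tau>: "a < \<tau>" "\<tau> < t"
    then have S: "p \<tau> \<in> S" and DD: "(\<tau>, y \<tau>) \<in> D" and y'\<tau>: "y' \<tau> = (u (\<tau>, y \<tau>), w (\<tau>, y \<tau>))"
      using pS D y' a by auto
    have "(y has_vector_derivative y' \<tau>) (at \<tau>)"
      using y[of \<tau>] at_within_Icc_at[of 0 \<tau> t] \<tau> a by simp
    then have yd: "(y has_derivative (\<lambda>h. h *\<^sub>R y' \<tau>)) (at \<tau>)"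
      by (simp add: has_vector_derivative_def)
    interpret linear "Dphi (p \<tau>)"
      using phi_deriv[OF S] has_derivative_linear by blast
    have "(p has_derivative (\<lambda>h. h *\<^sub>R (1, u (\<tau>, y \<tau>), 0))) (at \<tau>)"
      unfolding p_def by (auto intro!: derivative_eq_intros yd simp: y'\<tau>)
    from has_derivative_compose[OF this phi_deriv[OF S]]
    show "(e has_real_derivative e' \<tau>) (at \<tau>)"
      unfolding has_field_derivative_def e_def[abs_def] e'_def
      by (auto intro!: derivative_eq_intros yd simp: scale y'\<tau> algebra_simps simp del: scaleR_Pair)
    \<comment> \<open>The horizontal velocity on the curve is that on the graph plus a difference.
      The transport equation evaluates the first part; the differences of \<open>u\<close> and of
      \<open>w\<close> are at most \<open>K\<close> times the height, which gives the constant
      \<open>K + N * K\<close>.\<close>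
    have c1: "Dphi (p \<tau>) (1, u (\<tau>, y \<tau>), 0) = w (Phi (p \<tau>)) + Dphi (p \<tau>) (0, u (\<tau>, y \<tau>) - u (Phi (p \<tau>)), 0)"
      using add[of "(1, u (Phi (p \<tau>)), 0)" "(0, u (\<tau>, y \<tau>) - u (Phi (p \<tau>)), 0)"]
        transport_eq[OF S] by (simp add: v_eq)
    have Phi_p: "Phi (p \<tau>) = (\<tau>, fst (y \<tau>), phi (p \<tau>))"
      by (simp add: Phi_def p_def)
    have in_D: "(\<tau>, fst (y \<tau>), snd (y \<tau>)) \<in> D" "(\<tau>, fst (y \<tau>), phi (p \<tau>)) \<in> D"
      using DD Phi_D[OF S] by (simp_all add: Phi_p)
    have du: "norm (u (\<tau>, y \<tau>) - u (Phi (p \<tau>))) \<le> K * \<bar>e \<tau>\<bar>"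
      and dw: "\<bar>w (\<tau>, y \<tau>) - w (Phi (p \<tau>))\<bar> \<le> K * \<bar>e \<tau>\<bar>"
      using K(2)[OF in_D] K(3)[OF in_D] by (simp_all add: Phi_p e_def)
    have "norm (Dphi (p \<tau>) (0, u (\<tau>, y \<tau>) - u (Phi (p \<tau>)), 0))
        \<le> (\<Sum>b\<in>Basis. norm (Dphi (p \<tau>) b)) * norm (0::real, u (\<tau>, y \<tau>) - u (Phi (p \<tau>)), 0::real)"
      by (rule linear_norm_le_Basis_sum[OF linear_axioms])
    also have "\<dots> \<le> N * (K * \<bar>e \<tau>\<bar>)"
      using N[of \<tau>] \<tau> du by (intro mult_mono) (auto simp: norm_Pair intro: order_trans[OF sum_nonneg])
    finally show "\<bar>e' \<tau>\<bar> \<le> (K + N * K) * \<bar>e \<tau>\<bar>"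
      using dw unfolding e'_def c1 by (simp add: algebra_simps)
  next
    show "continuous_on {a..t} e"
      unfolding e_def
      by (intro continuous_intros y_cont continuous_on_compose2[OF Ck_on_imp_continuous_on[OF phi_Ck] p_cont])
        (use pS in auto)
    show "e t = 0"
      using at_t by (simp add: e_def p_def)
  qed (use a in auto)
  then show ?thesis
    by (simp add: e_def p_def)
qed

section \<open>The initial profile and the initial velocity\<close>

lemma phi0_deriv: "q \<in> strip \<Longrightarrow> (phi0 has_derivative frechet_derivative phi0 (at q)) (at q)"
  using Ck_on_frechet_derivative[OF Ckb_on_imp_Ck_on[OF phi0]] s2 by simp

lemma phi0_vertical_deriv:
  assumes "(x, l) \<in> strip"
  shows "((\<lambda>m. phi0 (x, m)) has_real_derivative H0 (x, l)) (at l)"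
    "H0 (x, l) = frechet_derivative phi0 (at (x, l)) (0, 1)"
proof -
  note d = phi0_deriv[OF assms]
  have "frechet_derivative phi0 (at (x, l)) (0, k) = k *\<^sub>R frechet_derivative phi0 (at (x, l)) (0, 1)" for k
    using linear_scale[OF has_derivative_linear[OF d], of k "(0, 1)"] by simp
  then have *: "(\<lambda>k. frechet_derivative phi0 (at (x, l)) (0, k)) = (\<lambda>k. k *\<^sub>R frechet_derivative phi0 (at (x, l)) (0, 1))"
    by blast
  have "((\<lambda>m. (x, m)) has_derivative (\<lambda>k. (0, k))) (at l)"
    by (auto intro!: derivative_eq_intros)
  from has_derivative_compose[OF this d]
  have D: "((\<lambda>m. phi0 (x, m)) has_vector_derivative frechet_derivative phi0 (at (x, l)) (0, 1)) (at l)"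
    unfolding has_vector_derivative_def * .
  then show "H0 (x, l) = frechet_derivative phi0 (at (x, l)) (0, 1)"
    by (simp add: H0 vector_derivative_at)
  with D show "((\<lambda>m. phi0 (x, m)) has_real_derivative H0 (x, l)) (at l)"
    by (simp add: has_real_derivative_iff_has_vector_derivative)
qed

text \<open>A real infimum is a lower bound only for a set bounded below, which is why the bounded
  derivatives of \<open>phi0\<close> enter.\<close>

lemma H0_pos:
  assumes "q \<in> strip"
  shows "H0 q > 0"
proof -
  obtain K where "K \<ge> 0" and K: "\<And>q k. q \<in> strip \<Longrightarrow> norm (frechet_derivative phi0 (at q) k) \<le> K * norm k"
    using Ckb_on_derivative_bound[OF phi0 s_pos] by blast
  have "- K \<le> H0 (x, l)" if "(x, l) \<in> strip" for x l
  proof -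
    have "\<bar>H0 (x, l)\<bar> \<le> K"
      unfolding phi0_vertical_deriv(2)[OF that] using K[OF that, of "(0, 1)"] by (simp add: norm_Pair)
    then show ?thesis by linarith
  qed
  then have "bdd_below ((\<lambda>(x, l). vector_derivative (\<lambda>m. phi0 (x, m)) (at l)) ` strip)"
    by (intro bdd_belowI[of _ "- K"]) (auto simp: H0)
  from cINF_lower[OF this assms] phi0_inf show ?thesis
    by (cases q) (auto simp: H0)
qed

text \<open>The boundary limits give only weak inequalities, at \<open>l / 2\<close> and
  \<open>(1 + l) / 2\<close>; strict monotonicity between these points and \<open>l\<close> makes
  them strict.\<close>

lemma phi0_fluid:
  assumes "(x, l) \<in> strip"
  shows "(x, phi0 (x, l)) \<in> fluid_domain zb eta0"
proof -
  have l: "0 < l" "l < 1" using assms by (auto simp: strip_def)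
  have mono: "phi0 (x, a) < phi0 (x, b)" if "0 < a" "a < b" "b < 1" for a b
  proof (rule DERIV_pos_imp_increasing[OF \<open>a < b\<close>])
    fix m assume "a \<le> m" "m \<le> b"
    then have "(x, m) \<in> strip" using that by (simp add: strip_def)
    then show "\<exists>y. ((\<lambda>m. phi0 (x, m)) has_real_derivative y) (at m) \<and> 0 < y"
      using phi0_vertical_deriv(1) H0_pos by blast
  qed
  have ev0: "\<forall>\<^sub>F m in at_right 0. m \<in> {0<..<l / 2}" and ev1: "\<forall>\<^sub>F m in at_left 1. m \<in> {(1 + l) / 2<..<1}"
    using eventually_at_right_real[of 0 "l / 2"] eventually_at_left_real[of "(1 + l) / 2" 1] l by auto
  have "((\<lambda>m. phi0 (x, m)) \<longlongrightarrow> zb x) (at_right 0)"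
  proof (rule filterlim_compose[OF phi0_bottom])
    show "LIM m at_right 0. (x, m) :> at (x, 0) within strip"
      unfolding filterlim_at
      using ev0 by (intro conjI tendsto_intros) (use l in \<open>auto elim!: eventually_mono simp: strip_def\<close>)
  qed
  moreover have "\<forall>\<^sub>F m in at_right 0. phi0 (x, m) \<le> phi0 (x, l / 2)"
    using ev0 by eventually_elim (use mono[of _ "l / 2"] l in \<open>auto intro: less_imp_le\<close>)
  ultimately have "zb x \<le> phi0 (x, l / 2)"
    by (rule tendsto_upperbound) simp
  moreover have "((\<lambda>m. phi0 (x, m)) \<longlongrightarrow> eta0 x) (at_left 1)"
  proof (rule filterlim_compose[OF phi0_surface])
    show "LIM m at_left 1. (x, m) :> at (x, 1) within strip"
      unfolding filterlim_at
      using ev1 l by (intro conjI tendsto_intros) (auto elim!: eventually_mono simp: strip_def)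
  qed
  moreover have "\<forall>\<^sub>F m in at_left 1. phi0 (x, (1 + l) / 2) \<le> phi0 (x, m)"
    using ev1 by eventually_elim (use mono[of "(1 + l) / 2"] l in \<open>auto intro: less_imp_le\<close>)
  ultimately have "zb x \<le> phi0 (x, l / 2)" "phi0 (x, (1 + l) / 2) \<le> eta0 x"
    by (auto intro: tendsto_lowerbound)
  then show ?thesis
    using mono[of "l / 2" l] mono[of l "(1 + l) / 2"] l by (auto simp: fluid_domain_def)
qed

lemma phi_tendsto: "(x, l) \<in> strip \<Longrightarrow> (phi \<longlongrightarrow> phi0 (x, l)) (at (0, x, l) within S)"
  using phi by (auto simp: transport_solution_def S_def)

lemma coords_tendsto:
  "((\<lambda>p. fst p) \<longlongrightarrow> 0) (at (0, x, l) within S)"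
  "((\<lambda>p. fst (snd p)) \<longlongrightarrow> x) (at (0, x, l) within S)"
  "((\<lambda>p. snd (snd p)) \<longlongrightarrow> l) (at (0, x, l) within S)"
  by (auto intro!: tendsto_eq_intros)

lemma eventually_S: "\<forall>\<^sub>F p in at q within S. p \<in> S"
  by (simp add: eventually_at_filter)

lemma v_tendsto:
  assumes "(x, l) \<in> strip"
  shows "(v \<longlongrightarrow> v0 (x, l)) (at (0, x, l) within S)"
proof -
  have "(u \<longlongrightarrow> u0 (x, phi0 (x, l))) (at (0, x, phi0 (x, l)) within D)"
    using euler phi0_fluid[OF assms] by (simp add: hydrostatic_euler_def Let_def D_def)
  moreover have "LIM p at (0, x, l) within S. Phi p :> at (0, x, phi0 (x, l)) within D"
    unfolding filterlim_at
  proof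
    show "\<forall>\<^sub>F p in at (0, x, l) within S. Phi p \<in> D \<and> Phi p \<noteq> (0, x, phi0 (x, l))"
      using eventually_S by eventually_elim (auto simp: Phi_D, auto simp: Phi_def mem_S)
    show "(Phi \<longlongrightarrow> (0, x, phi0 (x, l))) (at (0, x, l) within S)"
      unfolding Phi_def case_prod_beta
      using phi_tendsto[OF assms] by (intro tendsto_intros coords_tendsto) auto
  qed
  ultimately show ?thesis
    unfolding v_eq[abs_def] v0 by (rule filterlim_compose)
qed

section \<open>Backward characteristics near the initial time\<close>

text \<open>The surface converges to \<open>eta0\<close> jointly in time and space, and the bottom
  is continuous, so both stay away from height \<open>z\<close> nearby. The box is convex, as the
  Lipschitz bounds and the extension of the velocity require.\<close>

lemma initial_box:
  assumes "(x, z) \<in> fluid_domain zb eta0"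
  obtains r where "r > 0" "{0<..<r} \<times> (ball x r \<times> ball z r) \<subseteq> D"
proof -
  define e where "e = min (z - zb x) (eta0 x - z) / 2"
  have e: "e > 0" "zb x + e < z" "z + e < eta0 x"
    using assms by (auto simp: e_def fluid_domain_def min_def field_simps)
  have "(eta \<longlongrightarrow> eta0 x) (at (0, x) within {0<..<T} \<times> UNIV)"
    using euler by (simp add: hydrostatic_euler_def Let_def)
  from order_tendstoD(1)[OF this e(3)]
  obtain r1 where r1: "r1 > 0" "\<And>t y. 0 < t \<Longrightarrow> t < T \<Longrightarrow> dist (t, y) (0, x) < r1 \<Longrightarrow> z + e < eta (t, y)"
    by (auto simp: eventually_at)
  have "isCont zb x"
    using Ck_on_imp_continuous_on[OF Ckb_on_imp_Ck_on[OF zb]] by (simp add: continuous_on_eq_continuous_at)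
  then have "(zb \<longlongrightarrow> zb x) (nhds x)"
    by (simp add: isCont_def tendsto_at_iff_tendsto_nhds)
  from order_tendstoD(2)[OF this, of "z - e"]
  obtain r2 where r2: "r2 > 0" "\<And>y. dist y x < r2 \<Longrightarrow> zb y < z - e"
    using e by (auto simp: eventually_nhds_metric)
  \<comment> \<open>Half of \<open>r1\<close>, because the time and the horizontal displacement both
    contribute to the distance in spacetime.\<close>
  define r where "r = min (min (r1 / 2) r2) (min e T)"
  have "{0<..<r} \<times> (ball x r \<times> ball z r) \<subseteq> D"
  proof clarify
    fix t y \<zeta> assume t: "t \<in> {0<..<r}" and y: "y \<in> ball x r" and "\<zeta> \<in> ball z r"
    have "dist (t, y) (0, x) \<le> dist t 0 + dist y x"
      using norm_Pair_le[of "t - 0" "y - x"] by (simp add: dist_norm)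
    also have "\<dots> < r1"
      using t y by (auto simp: r_def dist_commute)
    finally have "z + e < eta (t, y)"
      using r1(2) t by (auto simp: r_def)
    moreover have "zb y < z - e"
      using r2(2) y by (auto simp: r_def dist_commute)
    ultimately show "(t, y, \<zeta>) \<in> D"
      using t \<open>\<zeta> \<in> ball z r\<close>
      by (auto simp: D_def fluid_spacetime_def fluid_domain_def r_def dist_real_def)
  qed
  moreover have "r > 0"
    using r1 r2 e Tstar by (auto simp: r_def)
  ultimately show ?thesis
    using that by blast
qed

text \<open>Speed at most \<open>M\<close> and \<open>M * t < r / 2\<close> keep the backward
  characteristic of \<open>G\<close> in the box, where \<open>G\<close> is the true velocity. It
  therefore stays on the graph of \<open>phi\<close> at level \<open>l\<close> at positive times,
  and the limit at time 0 puts its foot on the graph of \<open>phi0\<close>.\<close>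

lemma characteristic_foot:
  fixes G :: "real \<times> (real^'d) \<times> real \<Rightarrow> (real^'d) \<times> real"
  assumes G: "L-lipschitz_on UNIV G" "\<And>p. norm (G p) \<le> M"
    and box: "{0<..<r} \<times> (ball x0 r \<times> ball z0 r) \<subseteq> D"
    and GF: "\<And>p. p \<in> {0<..<r} \<times> (ball x0 r \<times> ball z0 r) \<Longrightarrow> G p = (u p, w p)"
    and p: "(t, x, l) \<in> S" "t < r" "dist x x0 < r / 2" "dist (phi (t, x, l)) z0 < r / 2"
    and small: "L * t \<le> 1 / 2" "M * t < r / 2"
  obtains y where "y t = (x, phi (t, x, l))"
    "\<And>\<tau>. \<tau> \<in> {0..t} \<Longrightarrow> (y has_vector_derivative G (\<tau>, y \<tau>)) (at \<tau> within {0..t})"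
    "snd (y 0) = phi0 (fst (y 0), l)" "dist (fst (y 0)) x \<le> M * t"
proof -
  have t: "0 < t" "t < Tstar" and l: "0 < l" "l < 1"
    using p(1) by (auto simp: mem_S)
  obtain y where yt: "y t = (x, phi (t, x, l))"
    and y: "\<And>\<tau>. \<tau> \<in> {0..t} \<Longrightarrow> (y has_vector_derivative G (\<tau>, y \<tau>)) (at \<tau> within {0..t})"
    using lipschitz_ode_solution[OF G(1) less_imp_le[OF t(1)] small(1)] by blast
  have M0: "M \<ge> 0"
    using G(2) norm_ge_zero order_trans by blast
  have disp: "dist (y \<tau>) (y t) \<le> M * t" if "\<tau> \<in> {0..t}" for \<tau>
  proof -
    have "norm (y \<tau> - y t) \<le> M * \<bar>\<tau> - t\<bar>"
      by (rule vector_derivative_norm_bound[OF y G(2) that]) (use t in auto)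
    also have "\<dots> \<le> M * t"
      using that M0 by (intro mult_left_mono) auto
    finally show ?thesis by (simp add: dist_norm)
  qed
  have inbox: "(\<tau>, y \<tau>) \<in> {0<..<r} \<times> (ball x0 r \<times> ball z0 r)" if "\<tau> \<in> {0<..t}" for \<tau>
  proof -
    have d: "dist (y \<tau>) (y t) < r / 2"
      using disp[of \<tau>] that small by simp
    have "dist (fst (y \<tau>)) x < r / 2"
      using dist_fst_le[of "y \<tau>" "y t"] d yt by simp
    then have "dist (fst (y \<tau>)) x0 < r"
      using p(3) dist_triangle[of "fst (y \<tau>)" x0 x] by simp
    moreover have "dist (snd (y \<tau>)) (phi (t, x, l)) < r / 2"
      using dist_snd_le[of "y \<tau>" "y t"] d yt by simp
    then have "dist (snd (y \<tau>)) z0 < r"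
      using p(4) dist_triangle[of "snd (y \<tau>)" z0 "phi (t, x, l)"] by simp
    ultimately show ?thesis
      using that p(2) by (cases "y \<tau>") (auto simp: dist_commute)
  qed
  have graph: "snd (y \<tau>) = phi (\<tau>, fst (y \<tau>), l)" if "\<tau> \<in> {0<..t}" for \<tau>
    by (rule characteristic_on_graph[OF t l y _ _ _ that]) (use inbox box GF yt in auto)
  have right: "at 0 within {0..t} = at_right 0"
    using t by (simp add: at_within_Icc_at_right)
  have "(y \<longlongrightarrow> y 0) (at_right 0)"
    using has_vector_derivative_continuous[OF y[of 0]] t by (simp add: continuous_within right)
  then have lims: "((\<lambda>\<tau>. fst (y \<tau>)) \<longlongrightarrow> fst (y 0)) (at_right 0)" "((\<lambda>\<tau>. snd (y \<tau>)) \<longlongrightarrow> snd (y 0)) (at_right 0)"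
    by (auto intro: tendsto_intros)
  have ev: "\<forall>\<^sub>F \<tau> in at_right 0. \<tau> \<in> {0<..<t}"
    using eventually_at_right_real t by blast
  \<comment> \<open>The base point moves along the curve, so the convergence of \<open>phi\<close>
    is used jointly in time and space.\<close>
  have "LIM \<tau> at_right 0. (\<tau>, fst (y \<tau>), l) :> at (0, fst (y 0), l) within S"
    unfolding filterlim_at
  proof
    show "\<forall>\<^sub>F \<tau> in at_right 0. (\<tau>, fst (y \<tau>), l) \<in> S \<and> (\<tau>, fst (y \<tau>), l) \<noteq> (0, fst (y 0), l)"
      using ev by eventually_elim (use t l in \<open>auto simp: mem_S\<close>)
    show "((\<lambda>\<tau>. (\<tau>, fst (y \<tau>), l)) \<longlongrightarrow> (0, fst (y 0), l)) (at_right 0)"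
      by (intro tendsto_intros lims)
  qed
  from filterlim_compose[OF phi_tendsto this]
  have "((\<lambda>\<tau>. phi (\<tau>, fst (y \<tau>), l)) \<longlongrightarrow> phi0 (fst (y 0), l)) (at_right 0)"
    using l by (simp add: strip_def)
  moreover have "\<forall>\<^sub>F \<tau> in at_right 0. phi (\<tau>, fst (y \<tau>), l) = snd (y \<tau>)"
    using ev by eventually_elim (simp add: graph)
  ultimately have "((\<lambda>\<tau>. snd (y \<tau>)) \<longlongrightarrow> phi0 (fst (y 0), l)) (at_right 0)"
    by (rule Lim_transform_eventually)
  then have "snd (y 0) = phi0 (fst (y 0), l)"
    using lims(2) tendsto_unique trivial_limit_at_right_real by blast
  moreover have "dist (fst (y 0)) x \<le> M * t"
    using order_trans[OF dist_fst_le disp[of 0]] t yt by simp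
  ultimately show ?thesis
    using that yt y by blast
qed

text \<open>Two points on one vertical line have feet over different points \<open>a\<close> and
  \<open>b\<close>. Moving the second foot from \<open>b\<close> to \<open>a\<close> costs
  \<open>K0 * norm (b - a)\<close>, itself of order \<open>t\<close> times the height difference.
  The point \<open>a\<close> depends only on the characteristic at level \<open>l\<close>, so it
  stays fixed as \<open>m\<close> tends to \<open>l\<close>. The error is relative to
  \<open>H\<close>, for which no bound near time 0 is known yet.\<close>

lemma H_compare:
  assumes q0: "(x0, l0) \<in> strip"
  obtains C where "C \<ge> 0"
    "\<forall>\<^sub>F p in at (0, x0, l0) within S. \<exists>a. dist a (fst (snd p)) \<le> C * fst p
       \<and> \<bar>H p - H0 (a, snd (snd p))\<bar> \<le> C * fst p * \<bar>H p\<bar>"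
proof -
  define z0 where "z0 = phi0 (x0, l0)"
  obtain r where r: "r > 0" and box: "{0<..<r} \<times> (ball x0 r \<times> ball z0 r) \<subseteq> D" (is "?B \<subseteq> D")
    using initial_box[OF phi0_fluid[OF q0]] unfolding z0_def by blast
  have convB: "convex ?B"
    by (intro convex_Times convex_ball convex_real_interval)
  have neB: "?B \<noteq> {}"
    using r by (auto simp: times_eq_iff)
  obtain Ku where Ku: "Ku \<ge> 0" "\<And>C p q. convex C \<Longrightarrow> C \<subseteq> D \<Longrightarrow> p \<in> C \<Longrightarrow> q \<in> C \<Longrightarrow> norm (u p - u q) \<le> Ku * norm (p - q)"
    using Ckb_on_imp_lipschitz[OF u s_pos] unfolding D_def by blast
  obtain Kw where Kw: "Kw \<ge> 0" "\<And>C p q. convex C \<Longrightarrow> C \<subseteq> D \<Longrightarrow> p \<in> C \<Longrightarrow> q \<in> C \<Longrightarrow> norm (w p - w q) \<le> Kw * norm (p - q)"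
    using Ckb_on_imp_lipschitz[OF w s_pos] unfolding D_def by blast
  obtain K0 where K0: "K0 \<ge> 0" "\<And>C p q. convex C \<Longrightarrow> C \<subseteq> strip \<Longrightarrow> p \<in> C \<Longrightarrow> q \<in> C \<Longrightarrow> norm (phi0 p - phi0 q) \<le> K0 * norm (p - q)"
    using Ckb_on_imp_lipschitz[OF phi0 s_pos] by blast
  have conv_strip: "convex (strip :: ((real^'d) \<times> real) set)"
    unfolding strip_def by (intro convex_Times convex_real_interval convex_UNIV)
  obtain Mu where Mu: "\<And>p. p \<in> D \<Longrightarrow> norm (u p) \<le> Mu"
    using Ckb_on_imp_bounded[OF u] unfolding bounded_iff D_def by blast
  obtain Mw where Mw: "\<And>p. p \<in> D \<Longrightarrow> norm (w p) \<le> Mw"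
    using Ckb_on_imp_bounded[OF w] unfolding bounded_iff D_def by blast
  define L where "L = Ku + Kw"
  define M where "M = Mu + Mw"
  have lip: "L-lipschitz_on ?B (\<lambda>p. (u p, w p))"
  proof (rule lipschitz_onI)
    fix p q assume pq: "p \<in> ?B" "q \<in> ?B"
    have "norm ((u p, w p) - (u q, w q)) \<le> norm (u p - u q) + norm (w p - w q)"
      using norm_Pair_le[of "u p - u q" "w p - w q"] by simp
    also have "\<dots> \<le> L * norm (p - q)"
      using Ku(2)[OF convB box pq] Kw(2)[OF convB box pq] by (simp add: L_def distrib_right)
    finally show "dist (u p, w p) (u q, w q) \<le> L * dist p q"
      by (simp only: dist_norm)
  qed (use Ku Kw in \<open>simp add: L_def\<close>)
  have bnd: "norm (u p, w p) \<le> M" if "p \<in> ?B" for p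
  proof -
    have "p \<in> D" using that box by blast
    then show ?thesis
      using norm_Pair_le[of "u p" "w p"] Mu[of p] Mw[of p] by (simp add: M_def)
  qed
  obtain G where G: "L-lipschitz_on UNIV G" "\<And>p. norm (G p) \<le> M" "\<And>p. p \<in> ?B \<Longrightarrow> G p = (u p, w p)"
    using lipschitz_extend_convex[OF lip convB neB bnd] by blast
  have L0: "L \<ge> 0" and M0: "M \<ge> 0"
    using lipschitz_on_nonneg[OF G(1)] G(2) norm_ge_zero order_trans by blast+
  \<comment> \<open>The conditions for tracing a point back. They persist under small vertical moves
    (\<open>ev_near_vertical\<close>), so the points with \<open>m\<close> close to \<open>l\<close>
    can be traced back at the same time.\<close>
  define near where "near = (\<lambda>(t, x, l). (t, x, l) \<in> S \<and> t < r \<and> dist x x0 < r / 2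
      \<and> dist (phi (t, x, l)) z0 < r / 2 \<and> L * t < 1 / 2 \<and> M * t < r / 2)"
  have foot: "\<exists>y. y t = (x, phi (t, x, l)) \<and>
      (\<forall>\<tau>\<in>{0..t}. (y has_vector_derivative G (\<tau>, y \<tau>)) (at \<tau> within {0..t})) \<and>
      snd (y 0) = phi0 (fst (y 0), l) \<and> dist (fst (y 0)) x \<le> M * t" if "near (t, x, l)" for t x l
    using that characteristic_foot[OF G(1,2) box G(3)] unfolding near_def
    by (metis (no_types, lifting) case_prod_conv less_imp_le)
  have ev_near: "\<forall>\<^sub>F p in at (0, x0, l0) within S. near p"
  proof -
    note c = coords_tendsto[where x = x0 and l = l0]
    have "((\<lambda>p. L * fst p) \<longlongrightarrow> L * 0) (at (0, x0, l0) within S)"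
      "((\<lambda>p. M * fst p) \<longlongrightarrow> M * 0) (at (0, x0, l0) within S)"
      by (intro tendsto_intros c)+
    note lims = order_tendstoD(2)[OF c(1), of r] order_tendstoD(2)[OF this(1), of "1 / 2"]
      order_tendstoD(2)[OF this(2), of "r / 2"] tendstoD[OF c(2), of "r / 2"]
      tendstoD[OF phi_tendsto[OF q0], of "r / 2"]
    have "\<forall>\<^sub>F p in at (0, x0, l0) within S. fst p < r"
      "\<forall>\<^sub>F p in at (0, x0, l0) within S. L * fst p < 1 / 2"
      "\<forall>\<^sub>F p in at (0, x0, l0) within S. M * fst p < r / 2"
      "\<forall>\<^sub>F p in at (0, x0, l0) within S. dist (fst (snd p)) x0 < r / 2"
      "\<forall>\<^sub>F p in at (0, x0, l0) within S. dist (phi p) z0 < r / 2"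
      using lims r unfolding z0_def by simp_all
    then show ?thesis
      using eventually_S by eventually_elim (auto simp: near_def)
  qed
  have ev_near_vertical: "\<forall>\<^sub>F m in at l. near (t, x, m)" if "near (t, x, l)" for t x l
  proof -
    have S: "(t, x, l) \<in> S" using that by (simp add: near_def)
    have "isCont (\<lambda>m. phi (t, x, m)) l"
      using has_derivative_slice_vertical[OF phi_deriv[OF S]] has_vector_derivative_continuous by blast
    then have "((\<lambda>m. dist (phi (t, x, m)) z0) \<longlongrightarrow> dist (phi (t, x, l)) z0) (at l)"
      by (auto simp: isCont_def intro!: tendsto_intros)
    from order_tendstoD(2)[OF this, of "r / 2"]
    have "\<forall>\<^sub>F m in at l. dist (phi (t, x, m)) z0 < r / 2"
      using that by (simp add: near_def)
    moreover have "\<forall>\<^sub>F m in at l. m \<in> {0<..<1}"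
      using S by (intro eventually_at_in_open') (auto simp: mem_S)
    ultimately show ?thesis
      by eventually_elim (use that in \<open>auto simp: near_def mem_S\<close>)
  qed
  \<comment> \<open>\<open>M\<close> bounds the horizontal shift of the foot; \<open>2 * L\<close>
    comes from \<open>ode_solutions_displacement\<close>, and the factor \<open>1 + K0\<close>
    includes the cost of moving \<open>b\<close> to \<open>a\<close>.\<close>
  define C where "C = max M (2 * L * (1 + K0))"
  have C: "M \<le> C" "2 * L * (1 + K0) \<le> C" "C \<ge> 0"
    using M0 by (auto simp: C_def)
  have compare: "\<exists>a. dist a x \<le> C * t \<and> \<bar>H (t, x, l) - H0 (a, l)\<bar> \<le> C * t * \<bar>H (t, x, l)\<bar>"
    if near: "near (t, x, l)" for t x l
  proof -
    have S: "(t, x, l) \<in> S" and t: "t > 0" "L * t \<le> 1 / 2" and l: "0 < l" "l < 1"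
      using near by (auto simp: near_def mem_S)
    obtain y where y: "y t = (x, phi (t, x, l))"
      "\<And>\<tau>. \<tau> \<in> {0..t} \<Longrightarrow> (y has_vector_derivative G (\<tau>, y \<tau>)) (at \<tau> within {0..t})"
      "snd (y 0) = phi0 (fst (y 0), l)" "dist (fst (y 0)) x \<le> M * t"
      using foot[OF near] by blast
    define a where "a = fst (y 0)"
    have al: "(a, m) \<in> strip \<longleftrightarrow> 0 < m \<and> m < 1" for a :: "real^'d" and m
      by (auto simp: strip_def)
    have diff: "\<bar>(phi (t, x, m) - phi (t, x, l)) - (phi0 (a, m) - phi0 (a, l))\<bar>
        \<le> C * t * \<bar>phi (t, x, m) - phi (t, x, l)\<bar>" if nm: "near (t, x, m)" for m
    proof -
      obtain z where z: "z t = (x, phi (t, x, m))"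
        "\<And>\<tau>. \<tau> \<in> {0..t} \<Longrightarrow> (z has_vector_derivative G (\<tau>, z \<tau>)) (at \<tau> within {0..t})"
        "snd (z 0) = phi0 (fst (z 0), m)"
        using foot[OF nm] by blast
      have m: "0 < m" "m < 1"
        using nm by (auto simp: near_def mem_S)
      define \<Delta> where "\<Delta> = phi (t, x, m) - phi (t, x, l)"
      define b where "b = fst (z 0)"
      have zy: "z t - y t = (0, \<Delta>)"
        by (simp add: z y \<Delta>_def)
      have eq: "(z 0 - y 0) - (z t - y t) = (b - a, (phi0 (b, m) - phi0 (a, l)) - \<Delta>)"
        unfolding zy using z(3) y(3) by (simp add: prod_eq_iff a_def b_def)
      have "norm ((z 0 - y 0) - (z t - y t)) \<le> 2 * L * t * norm (z t - y t)"
        using ode_solutions_displacement[OF G(1) less_imp_le[OF t(1)] t(2) z(2) y(2)] .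
      then have n: "norm (b - a, (phi0 (b, m) - phi0 (a, l)) - \<Delta>) \<le> 2 * L * t * \<bar>\<Delta>\<bar>"
        unfolding eq by (simp add: zy norm_Pair)
      have n1: "norm (b - a) \<le> 2 * L * t * \<bar>\<Delta>\<bar>"
        and n2: "\<bar>(phi0 (b, m) - phi0 (a, l)) - \<Delta>\<bar> \<le> 2 * L * t * \<bar>\<Delta>\<bar>"
        using order_trans[OF norm_fst_le n] order_trans[OF norm_snd_le n] by auto
      have "\<bar>phi0 (b, m) - phi0 (a, m)\<bar> \<le> K0 * norm (b - a)"
        using K0(2)[OF conv_strip subset_refl, of "(b, m)" "(a, m)"] m by (simp add: al norm_Pair)
      also have "\<dots> \<le> K0 * (2 * L * t * \<bar>\<Delta>\<bar>)"
        using n1 K0(1) by (rule mult_left_mono)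
      finally have "\<bar>\<Delta> - (phi0 (a, m) - phi0 (a, l))\<bar> \<le> 2 * L * t * \<bar>\<Delta>\<bar> + K0 * (2 * L * t * \<bar>\<Delta>\<bar>)"
        using n2 by linarith
      also have "\<dots> = 2 * L * (1 + K0) * (t * \<bar>\<Delta>\<bar>)"
        by (simp add: algebra_simps)
      also have "\<dots> \<le> C * (t * \<bar>\<Delta>\<bar>)"
        using C(2) t by (intro mult_right_mono) auto
      finally show ?thesis
        by (simp add: \<Delta>_def mult.assoc)
    qed
    define Q where "Q m = (phi (t, x, m) - phi (t, x, l)) / (m - l)" for m
    define R where "R m = (phi0 (a, m) - phi0 (a, l)) / (m - l)" for m
    have "((\<lambda>m. phi (t, x, m)) has_real_derivative H (t, x, l)) (at l)"
      using has_derivative_slice_vertical[OF phi_deriv[OF S]]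
      by (simp add: H_eq[OF S] has_real_derivative_iff_has_vector_derivative)
    then have Q: "(Q \<longlongrightarrow> H (t, x, l)) (at l)"
      by (simp add: Q_def[abs_def] has_field_derivative_iff)
    have "((\<lambda>m. phi0 (a, m)) has_real_derivative H0 (a, l)) (at l)"
      using phi0_vertical_deriv(1) l by (simp add: al)
    then have R: "(R \<longlongrightarrow> H0 (a, l)) (at l)"
      by (simp add: R_def[abs_def] has_field_derivative_iff)
    have "\<forall>\<^sub>F m in at l. \<bar>Q m - R m\<bar> \<le> C * t * \<bar>Q m\<bar>"
      using ev_near_vertical[OF near] eventually_neq_at_within[of l l UNIV]
    proof eventually_elim
      case (elim m)
      have "Q m - R m = ((phi (t, x, m) - phi (t, x, l)) - (phi0 (a, m) - phi0 (a, l))) / (m - l)"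
        by (simp add: Q_def R_def diff_divide_distrib)
      then have "\<bar>Q m - R m\<bar> = \<bar>(phi (t, x, m) - phi (t, x, l)) - (phi0 (a, m) - phi0 (a, l))\<bar> / \<bar>m - l\<bar>"
        by (simp only: abs_divide)
      also have "\<dots> \<le> C * t * \<bar>phi (t, x, m) - phi (t, x, l)\<bar> / \<bar>m - l\<bar>"
        using diff[OF elim(1)] by (rule divide_right_mono) simp
      also have "\<dots> = C * t * \<bar>Q m\<bar>"
        by (simp add: Q_def abs_divide)
      finally show ?case .
    qed
    then have "\<bar>H (t, x, l) - H0 (a, l)\<bar> \<le> C * t * \<bar>H (t, x, l)\<bar>"
      by (rule tendsto_le[OF trivial_limit_at, rotated 2]) (intro tendsto_intros Q R)+
    moreover have "dist a x \<le> C * t"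
      using order_trans[OF y(4) mult_right_mono[OF C(1) less_imp_le[OF t(1)]]] by (simp add: a_def)
    ultimately show ?thesis by blast
  qed
  have "\<forall>\<^sub>F p in at (0, x0, l0) within S. \<exists>a. dist a (fst (snd p)) \<le> C * fst p
       \<and> \<bar>H p - H0 (a, snd (snd p))\<bar> \<le> C * fst p * \<bar>H p\<bar>"
    using ev_near
  proof eventually_elim
    case (elim p)
    then show ?case
      using compare[of "fst p" "fst (snd p)" "snd (snd p)"] by simp
  qed
  then show ?thesis
    using that C(3) by blast
qed

lemma H0_continuous: "continuous_on strip H0"
proof -
  have "Ck_on (Suc (s - 1)) phi0 strip"
    using Ckb_on_imp_Ck_on[OF phi0] s_pos by simp
  moreover have "(0, 1) \<in> (Basis :: ((real^'d) \<times> real) set)"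
    by (simp add: Basis_prod_def)
  ultimately have "Ck_on (s - 1) (\<lambda>q. frechet_derivative phi0 (at q) (0, 1)) strip"
    by simp
  then have "continuous_on strip (\<lambda>q. frechet_derivative phi0 (at q) (0, 1))"
    by (rule Ck_on_imp_continuous_on)
  then show ?thesis
    by (rule continuous_on_eq) (auto simp: phi0_vertical_deriv(2))
qed

text \<open>The comparison points converge to \<open>(x, l)\<close>, where \<open>H0\<close> is
  continuous. The relative error is absorbed first: once \<open>C * fst p < 1 / 2\<close>,
  \<open>H\<close> is at most twice \<open>H0\<close> at the comparison point in absolute value, so
  the error tends to 0.\<close>

lemma H_tendsto:
  assumes q: "(x, l) \<in> strip"
  shows "(H \<longlongrightarrow> H0 (x, l)) (at (0, x, l) within S)" (is "(H \<longlongrightarrow> ?h) ?F")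
proof -
  obtain C where C: "C \<ge> 0"
    "\<forall>\<^sub>F p in ?F. \<exists>a. dist a (fst (snd p)) \<le> C * fst p
       \<and> \<bar>H p - H0 (a, snd (snd p))\<bar> \<le> C * fst p * \<bar>H p\<bar>"
    using H_compare[OF q] .
  \<comment> \<open>The comparison point is chosen as a function of \<open>p\<close> so that its
    limit can be taken; the choice is meaningful close enough to the initial point.\<close>
  define a where "a p = (SOME a. dist a (fst (snd p)) \<le> C * fst p
       \<and> \<bar>H p - H0 (a, snd (snd p))\<bar> \<le> C * fst p * \<bar>H p\<bar>)" for p
  have a: "\<forall>\<^sub>F p in ?F. dist (a p) (fst (snd p)) \<le> C * fst p
       \<and> \<bar>H p - H0 (a p, snd (snd p))\<bar> \<le> C * fst p * \<bar>H p\<bar>"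
    using C(2) unfolding a_def by (rule eventually_mono) (rule someI_ex)
  note c = coords_tendsto[where x = x and l = l]
  have Ct: "((\<lambda>p. C * fst p) \<longlongrightarrow> 0) ?F"
    using tendsto_mult[OF tendsto_const c(1), of C] by simp
  have "((\<lambda>p. dist (a p) (fst (snd p))) \<longlongrightarrow> 0) ?F"
    by (rule tendsto_sandwich[OF _ _ tendsto_const Ct]) (use a in \<open>auto elim: eventually_mono\<close>)
  from tendsto_add[OF this tendsto_dist[OF c(2) tendsto_const, of x]]
  have "((\<lambda>p. dist (a p) (fst (snd p)) + dist (fst (snd p)) x) \<longlongrightarrow> 0) ?F"
    by simp
  then have "((\<lambda>p. dist (a p) x) \<longlongrightarrow> 0) ?F"
    by (rule Lim_null_comparison[rotated]) (simp add: dist_triangle)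
  then have "(a \<longlongrightarrow> x) ?F"
    by (simp add: tendsto_dist_iff[of a])
  then have "((\<lambda>p. (a p, snd (snd p))) \<longlongrightarrow> (x, l)) ?F"
    by (intro tendsto_intros c)
  moreover have "isCont H0 (x, l)"
    using continuous_on_eq_continuous_at[OF open_strip] H0_continuous q by blast
  ultimately have A: "((\<lambda>p. H0 (a p, snd (snd p))) \<longlongrightarrow> ?h) ?F"
    by (rule isCont_tendsto_compose[rotated])
  have "\<forall>\<^sub>F p in ?F. C * fst p < 1 / 2"
    using order_tendstoD(2)[OF Ct, of "1 / 2"] by simp
  with a eventually_S
  have "\<forall>\<^sub>F p in ?F. norm (H p - H0 (a p, snd (snd p))) \<le> C * fst p * (2 * \<bar>H0 (a p, snd (snd p))\<bar>)"
  proof eventually_elim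
    case (elim p)
    have t: "0 \<le> C * fst p"
      using elim C by (cases p) (auto simp: mem_S)
    have "C * fst p * \<bar>H p\<bar> \<le> 1 / 2 * \<bar>H p\<bar>"
      using elim by (intro mult_right_mono) auto
    then have "\<bar>H p\<bar> \<le> 2 * \<bar>H0 (a p, snd (snd p))\<bar>"
      using elim by linarith
    from mult_left_mono[OF this t] show ?case
      using elim by simp
  qed
  moreover have "((\<lambda>p. C * fst p * (2 * \<bar>H0 (a p, snd (snd p))\<bar>)) \<longlongrightarrow> 0) ?F"
    using tendsto_mult[OF Ct tendsto_mult[OF tendsto_const[of 2] tendsto_rabs[OF A]]] by simp
  ultimately have "((\<lambda>p. H p - H0 (a p, snd (snd p))) \<longlongrightarrow> 0) ?F"
    by (rule Lim_null_comparison)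
  from tendsto_add[OF this A] show ?thesis by simp
qed

lemma semi_lagrangian_system: "semi_lagrangian_system g Tstar zb H0 v0 H v"
proof -
  have S: "(t, x, l) \<in> S" if "t \<in> {0<..<Tstar}" "(x, l) \<in> strip" for t x l
    using that by (simp add: S_def)
  show ?thesis
    unfolding semi_lagrangian_system_def
    using mass_eq[OF S] velocity_pressure_eq[OF S] H_absolutely_integrable
      H_tendsto v_tendsto differentiable_diff[OF depth_differentiable]
    by (auto simp: integral_H S_def)
qed

end

theorem theorem2p4:
  fixes s :: nat and g T Tstar :: real
    and zb eta0 :: "real^'d::finite \<Rightarrow> real"
    and u0 :: "(real^'d) \<times> real \<Rightarrow> real^'d"
    and eta :: "real \<times> (real^'d) \<Rightarrow> real"
    and u :: "real \<times> (real^'d) \<times> real \<Rightarrow> real^'d"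
    and w :: "real \<times> (real^'d) \<times> real \<Rightarrow> real"
    and phi0 H0 :: "(real^'d) \<times> real \<Rightarrow> real"
    and v0 :: "(real^'d) \<times> real \<Rightarrow> real^'d"
    and phi H :: "real \<times> (real^'d) \<times> real \<Rightarrow> real"
    and v :: "real \<times> (real^'d) \<times> real \<Rightarrow> real^'d"
  assumes "CARD('d) \<in> {1, 2}" and "s \<ge> 2" and "T > 0" and "g > 0"
    and "Ckb_on s zb UNIV"
    and "hydrostatic_euler g T zb (\<lambda>_. 0) eta0 u0 eta u w"
    and "Ckb_on s eta ({0<..<T} \<times> UNIV)"
    and "Ckb_on s u (fluid_spacetime T zb eta)"
    and "Ckb_on s w (fluid_spacetime T zb eta)"
    and "Ckb_on s phi0 strip"
    and "\<And>x. (phi0 \<longlongrightarrow> zb x) (at (x, 0) within strip)"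
    and "\<And>x. (phi0 \<longlongrightarrow> eta0 x) (at (x, 1) within strip)"
    and "(INF (x, l)\<in>strip. vector_derivative (\<lambda>m. phi0 (x, m)) (at l)) > 0"
    and "0 < Tstar" and "Tstar \<le> T"
    and "transport_solution s Tstar zb eta u w phi0 phi"
    and "\<And>psi. transport_solution s Tstar zb eta u w phi0 psi \<Longrightarrow>
           \<forall>p\<in>{0<..<Tstar} \<times> strip. psi p = phi p"
    and "\<And>t. t \<in> {0<..<Tstar} \<Longrightarrow>
           Ck_diffeomorphism s (\<lambda>(x, l). (x, phi (t, x, l)))
             strip (fluid_domain zb (\<lambda>x. eta (t, x)))"
    and "\<And>t. t \<in> {0<..<Tstar} \<Longrightarrow>
           orientation_preserving_on (\<lambda>(x, l). (x, phi (t, x, l))) strip"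
    and "\<And>t x l. H (t, x, l) = vector_derivative (\<lambda>m. phi (t, x, m)) (at l)"
    and "\<And>t x l. v (t, x, l) = u (t, x, phi (t, x, l))"
    and "\<And>x l. H0 (x, l) = vector_derivative (\<lambda>m. phi0 (x, m)) (at l)"
    and "\<And>x l. v0 (x, l) = u0 (x, phi0 (x, l))"
  shows "Ck_on (s - 1) H ({0<..<Tstar} \<times> strip) \<and>
         Ck_on s v ({0<..<Tstar} \<times> strip) \<and>
         semi_lagrangian_system g Tstar zb H0 v0 H v"
proof -
  interpret semi_lagrangian s g T Tstar zb eta0 u0 eta u w phi0 H0 v0 phi H v
    by unfold_locales (fact assms)+
  show ?thesis
    using H_Ck v_Ck semi_lagrangian_system by (simp add: S_def)
qed

end
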